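(* For any $t\in\mathbb T$ and $\mu\in\mathcal P_0(\mathbb X_t)$, $$\mathbb V_{relax}(t,\mu)=\mathbb V_{global}(t,\mu):=\bigcap_{\varepsilon>0}\mathbb V^\varepsilon_{global}(t,\mu),$$ where $$\mathbb V^\varepsilon_{global}(t,\mu):=\Big\{\varphi\in\mathbb L^0(\mathbb X_t;\mathbb R):\ \exists\,\Lambda^*\in\mathcal M^\varepsilon_{global}(t,\mu)\text{ such that }\|\varphi-v(t,\Lambda^*;\cdot)\|_{\mathbb X_t}\le\varepsilon\Big\}.$$
   Context: Path dependent setting. $\mathbb T=\{0,\dots,T\}$; $\mathbb S$ finite, $|\mathbb S|=d$; $\mathbb X=\mathbb S^{T+1}$ with elements $\mathbf x=(\mathbf x_0,\dots,\mathbf x_T)$; $\mathbf x_{t\wedge\cdot}:=(\mathbf x_0,\dots,\mathbf x_t,\mathbf x_t,\dots,\mathbf x_t)$; $\mathbb X_t:=\{\mathbf x_{t\wedge\cdot}:\mathbf x\in\mathbb X\}$; $\mathbf x=_t\tilde{\mathbf x}$ means $\mathbf x_{t\wedge\cdot}=\tilde{\mathbf x}_{t\wedge\cdot}$; $\mathbb X^{t,\mathbf x}:=\{\tilde{\mathbf x}\in\mathbb X:\tilde{\mathbf x}=_t\mathbf x\}$, $\mathbb X^{t,\mathbf x}_s:=\mathbb X^{t,\mathbf x}\cap\mathbb X_s$ for $s\ge t$. $\mathcal P(\mathbb X_t)$: probability measures on $\mathbb X_t$ with $W_1(\mu,\nu):=\sum_{\mathbf x\in\mathbb X_t}|\mu(\mathbf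 x)-\nu(\mathbf x)|$; $\mathcal P_0(\mathbb X_t)$: those with full support. $X$ is the canonical process on $\mathbb X$; for $\mu\in\mathcal P(\mathbb X)$, $\mu_{t\wedge\cdot}:=\mu\circ X_{t\wedge\cdot}^{-1}$. A function is adapted if $\varphi(t,\mathbf x,\mu)=\varphi(t,\mathbf x_{t\wedge\cdot},\mu_{t\wedge\cdot})$. $\mathbb L^0(\mathbb X_t;\mathbb R)$: functions $\mathbb X_t\to\mathbb R$; $\|\varphi\|_{\mathbb X_t}:=\sup_{\mathbf x\in\mathbb X_t}|\varphi(\mathbf x)|$. Data: $\mathbb A\subset\mathbb R^{d_0}$ measurable; $q:\mathbb T\times\mathbb X\times\mathcal P(\mathbb X)\times\mathbb A\times\mathbb S\to(0,1)$ adapted with $\sum_{\tilde x}q(t,\mathbf x,\mu,a;\tilde x)=1$; $F:\mathbb T\times\mathbb X\times\mathcal P(\mathbb X)\times\mathbb A\to\mathbb R$ adapted; $G:\mathbb X\times\mathcal P(\mathbb X)\to\mathbb R$. Standing assumption: (i) $q\ge c_q$ for a constant $c_q>0$; (ii) $q$ is Lipschitz continuous in $(\mu,a)$ with constant $L_q$; (iii) $F,G$ are bounded by $C_0$ and uniformly continuous in $(\mu,a)$ with modulus $\rho$. $\mathcal A_{relax}$: adapted relaxed controls $\gamma:\mathbb T\times\mathbb X\to\mathcal P(\mathbb A)$. $\mathcal A_{path}$: adapted controls $\alpha:\mathbb T\times\mathbb X\to\mathbb A$ (identified with the relaxed control $\delta_{\alpha}$); $\mathcal A^t_{path}$: their restrictions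 $(\alpha(t,\cdot),\dots,\alpha(T-1,\cdot))$. For $m\in\mathcal P(\mathbb X)$, $\mathbf x\in\mathbb X_t$, $\tilde\gamma\in\mathcal A_{relax}$, $\mathbb P^{m;t,\mathbf x,\tilde\gamma}$ is given by $\mathbb P(X=_t\mathbf x)=1$, $\mathbb P(X_{s+1}=\bar x|X=_s\tilde{\mathbf x})=\int_{\mathbb A}q(s,\tilde{\mathbf x},m,a;\bar x)\tilde\gamma(s,\tilde{\mathbf x};da)$, $s\ge t$; $J(m;t,\mathbf x,\tilde\gamma):=\mathbb E^{\mathbb P^{m;t,\mathbf x,\tilde\gamma}}[G(X,m)+\sum_{r=t}^{T-1}\int_{\mathbb A}F(r,X,m,a)\tilde\gamma(r,X;da)]$; $v(m;t,\mathbf x):=\inf_{\tilde\gamma\in\mathcal A_{relax}}J(m;t,\mathbf x,\tilde\gamma)$. Relaxed set value: for $\mu\in\mathcal P_0(\mathbb X_t)$ and $\gamma\in\mathcal A_{relax}$, $\mathbb P^{t,\mu,\gamma}$ is given by $\mathbb P^{t,\mu,\gamma}\circ X_{t\wedge\cdot}^{-1}=\mu$, $\mathbb P^{t,\mu,\gamma}(X_{s+1}=\tilde x|X=_s\mathbf x)=\int_{\mathbb A}q(s,\mathbf x,\mu^\gamma,a;\tilde x)\gamma(s,\mathbf x;da)$ with $\mu^\gamma_{s\wedge\cdot}:=\mathbb P^{t,\mu,\gamma}\circ X_{s\wedge\cdot}^{-1}$; $J(t,\mu,\gamma;\mathbf x,\tilde\gamma):=J(\mu^\gamma;t,\mathbf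 x,\tilde\gamma)$. $\mathcal M^\varepsilon_{relax}(t,\mu)$: all $\gamma^*\in\mathcal A_{relax}$ with $J(t,\mu,\gamma^*;\mathbf x,\gamma^* )\le v(\mu^{\gamma^*};t,\mathbf x)+\varepsilon$ for all $\mathbf x\in\mathbb X_t$. $\mathbb V^\varepsilon_{relax}(t,\mu):=\{\varphi\in\mathbb L^0(\mathbb X_t;\mathbb R):\exists\gamma^*\in\mathcal M^\varepsilon_{relax}(t,\mu)\text{ s.t. }\|\varphi-J(t,\mu,\gamma^*;\cdot,\gamma^* )\|_{\mathbb X_t}\le\varepsilon\}$, $\mathbb V_{relax}(t,\mu):=\bigcap_{\varepsilon>0}\mathbb V^\varepsilon_{relax}(t,\mu)$. Global formulation: $\Xi_t:=\mathcal P(\mathbb X_t\times\mathcal A^t_{path})$. For $\Lambda\in\Xi_t$, $\mu^\Lambda$ is defined recursively by $\mu^\Lambda_{t\wedge\cdot}(\mathbf x):=\Lambda(\mathbf x,\mathcal A^t_{path})$ and, for $s\ge t$, $\mathbf x\in\mathbb X_t$, $\tilde{\mathbf x}\in\mathbb X^{t,\mathbf x}_s$, $\mu^\Lambda_{s\wedge\cdot}(\tilde{\mathbf x}):=\int_{\mathcal A^t_{path}}\prod_{r=t}^{s-1}q(r,\tilde{\mathbf x},\mu^\Lambda,\alpha(r,\tilde{\mathbf x});\tilde{\mathbf x}_{r+1})\,\Lambda(\mathbf x,d\alpha)$. (When paired with initial path $\mathbf x$, $\alpha\in\mathcal A^t_{path}$ is identified with the finite family $\{\alpha(s,\tilde{\mathbf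 x}):t\le s\le T-1,\tilde{\mathbf x}\in\mathbb X^{t,\mathbf x}_s\}$.) $\Xi_t(\mu):=\{\Lambda\in\Xi_t:\mu^\Lambda_{t\wedge\cdot}=\mu\}$; $J(t,\Lambda;\mathbf x,\alpha):=J(\mu^\Lambda;t,\mathbf x,\alpha)$, $v(t,\Lambda;\mathbf x):=v(\mu^\Lambda;t,\mathbf x)$. $\Lambda^*\in\mathcal M^\varepsilon_{global}(t,\mu)$ iff $\Lambda^*\in\Xi_t(\mu)$ and $\int_{\mathcal A^t_{path}}[J(t,\Lambda^*;\mathbf x,\alpha)-v(t,\Lambda^*;\mathbf x)]\Lambda^*(\mathbf x,d\alpha)\le\varepsilon$ for all $\mathbf x\in\mathbb X_t$. *)

theory Defs
  imports "HOL-Probability.Probability"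
begin

text \<open>
  The state space is the finite type \<open>'s\<close>, the action space a set \<open>A\<close> in a Euclidean space.  A path
  is a function on \<open>{..T}\<close> (extensional outside), and a probability measure on paths is a \<open>pmf\<close>.
\<close>

locale mfg_data =
  fixes T :: nat
    and A :: "'a::euclidean_space set"
    and q :: "nat \<Rightarrow> (nat \<Rightarrow> 's::finite) \<Rightarrow> (nat \<Rightarrow> 's) pmf \<Rightarrow> 'a \<Rightarrow> 's \<Rightarrow> real"
    and F :: "nat \<Rightarrow> (nat \<Rightarrow> 's) \<Rightarrow> (nat \<Rightarrow> 's) pmf \<Rightarrow> 'a \<Rightarrow> real"
    and G :: "(nat \<Rightarrow> 's) \<Rightarrow> (nat \<Rightarrow> 's) pmf \<Rightarrow> real"
begin

subsection \<open>Paths and measures on paths\<close>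

definition paths :: "(nat \<Rightarrow> 's) set" where
  "paths = {..T} \<rightarrow>\<^sub>E UNIV"

definition stop :: "nat \<Rightarrow> (nat \<Rightarrow> 's) \<Rightarrow> nat \<Rightarrow> 's" where
  "stop t x = (\<lambda>r\<in>{..T}. x (min r t))"

definition stopped_paths :: "nat \<Rightarrow> (nat \<Rightarrow> 's) set" where
  "stopped_paths t = stop t ` paths"

definition path_probs :: "(nat \<Rightarrow> 's) pmf set" where
  "path_probs = {\<mu>. set_pmf \<mu> \<subseteq> paths}"

definition full_support_probs :: "nat \<Rightarrow> (nat \<Rightarrow> 's) pmf set" where
  "full_support_probs t = {\<mu>. set_pmf \<mu> = stopped_paths t}"

definition W1 :: "(nat \<Rightarrow> 's) pmf \<Rightarrow> (nat \<Rightarrow> 's) pmf \<Rightarrow> real" where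
  "W1 \<mu> \<nu> = (\<Sum>x\<in>paths. \<bar>pmf \<mu> x - pmf \<nu> x\<bar>)"

definition fun_norm :: "nat \<Rightarrow> ((nat \<Rightarrow> 's) \<Rightarrow> real) \<Rightarrow> real" where
  "fun_norm t \<phi> = (SUP x\<in>stopped_paths t. \<bar>\<phi> x\<bar>)"

text \<open>The real functions on \<open>stopped_paths t\<close>, represented extensionally.\<close>

definition L0 :: "nat \<Rightarrow> ((nat \<Rightarrow> 's) \<Rightarrow> real) set" where
  "L0 t = stopped_paths t \<rightarrow>\<^sub>E UNIV"

subsection \<open>Controls\<close>

definition action_space :: "'a measure" where
  "action_space = restrict_space borel A"

definition relaxed_controls :: "(nat \<Rightarrow> (nat \<Rightarrow> 's) \<Rightarrow> 'a measure) set" where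
  "relaxed_controls = {\<gamma>. \<forall>s\<le>T. \<forall>x\<in>paths.
     \<gamma> s x \<in> space (prob_algebra action_space) \<and> \<gamma> s x = \<gamma> s (stop s x)}"

text \<open>
  The measurable space of adapted controls restricted to the times \<open>t, \<dots>, T - 1\<close>; the
  \<open>\<sigma>\<close>-algebra is the Borel one of the finite power of \<open>A\<close>.
\<close>

definition path_controls :: "nat \<Rightarrow> (nat \<times> (nat \<Rightarrow> 's) \<Rightarrow> 'a) measure" where
  "path_controls t = restrict_space (Pi\<^sub>M ({t..<T} \<times> paths) (\<lambda>_. action_space))
     {\<alpha>. \<forall>s\<in>{t..<T}. \<forall>x\<in>paths. \<alpha> (s, x) = \<alpha> (s, stop s x)}"

text \<open>
  The relaxed control identified with a path control.  It is only ever evaluated at times in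
  \<open>{t..<T}\<close> and at elements of \<open>paths\<close>, where \<open>\<alpha>\<close> is specified.
\<close>

definition dirac_control :: "(nat \<times> (nat \<Rightarrow> 's) \<Rightarrow> 'a) \<Rightarrow> nat \<Rightarrow> (nat \<Rightarrow> 's) \<Rightarrow> 'a measure" where
  "dirac_control \<alpha> s x = return action_space (\<alpha> (s, x))"

subsection \<open>Dynamics, cost and value for a given flow of measures\<close>

text \<open>
  The law of the path stopped at \<open>Suc s\<close>, given that the path stopped at \<open>s\<close> is \<open>x\<close>: the next state
  has law \<open>\<integral> q(s, x, m, a; \<cdot>) \<nu>(da)\<close>.
\<close>

definition step :: "nat \<Rightarrow> (nat \<Rightarrow> 's) \<Rightarrow> (nat \<Rightarrow> 's) pmf \<Rightarrow> 'a measure \<Rightarrow> (nat \<Rightarrow> 's) pmf" where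
  "step s x m \<nu> = map_pmf (\<lambda>y. \<lambda>r\<in>{..T}. if r \<le> s then x r else y)
     (embed_pmf (\<lambda>y. \<integral>a. q s x m a y \<partial>\<nu>))"

text \<open>\<open>law m t x \<gamma> k\<close> is the law of the path stopped at time \<open>t + k\<close>.\<close>

primrec law :: "(nat \<Rightarrow> 's) pmf \<Rightarrow> nat \<Rightarrow> (nat \<Rightarrow> 's) \<Rightarrow> (nat \<Rightarrow> (nat \<Rightarrow> 's) \<Rightarrow> 'a measure) \<Rightarrow>
    nat \<Rightarrow> (nat \<Rightarrow> 's) pmf" where
  "law m t x \<gamma> 0 = return_pmf x"
| "law m t x \<gamma> (Suc k) =
     bind_pmf (law m t x \<gamma> k) (\<lambda>y. step (t + k) y m (\<gamma> (t + k) y))"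

definition J :: "(nat \<Rightarrow> 's) pmf \<Rightarrow> nat \<Rightarrow> (nat \<Rightarrow> 's) \<Rightarrow> (nat \<Rightarrow> (nat \<Rightarrow> 's) \<Rightarrow> 'a measure) \<Rightarrow> real" where
  "J m t x \<gamma> = measure_pmf.expectation (law m t x \<gamma> (T - t))
     (\<lambda>X. G X m + (\<Sum>r\<in>{t..<T}. \<integral>a. F r X m a \<partial>(\<gamma> r X)))"

definition v :: "(nat \<Rightarrow> 's) pmf \<Rightarrow> nat \<Rightarrow> (nat \<Rightarrow> 's) \<Rightarrow> real" where
  "v m t x = (INF \<gamma>\<in>relaxed_controls. J m t x \<gamma>)"

subsection \<open>Relaxed set value\<close>

text \<open>
  \<open>relaxed_flow t \<mu> \<gamma> k\<close> is the law of the path stopped at time \<open>t + k\<close>.  Since \<open>q\<close> is adapted, at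
  time \<open>s = t + k\<close> it depends on the flow only through the law of the path stopped at \<open>s\<close>, which
  makes the recursion explicit.
\<close>

primrec relaxed_flow :: "nat \<Rightarrow> (nat \<Rightarrow> 's) pmf \<Rightarrow> (nat \<Rightarrow> (nat \<Rightarrow> 's) \<Rightarrow> 'a measure) \<Rightarrow>
    nat \<Rightarrow> (nat \<Rightarrow> 's) pmf" where
  "relaxed_flow t \<mu> \<gamma> 0 = \<mu>"
| "relaxed_flow t \<mu> \<gamma> (Suc k) = bind_pmf (relaxed_flow t \<mu> \<gamma> k)
     (\<lambda>x. step (t + k) x (relaxed_flow t \<mu> \<gamma> k) (\<gamma> (t + k) x))"

definition relaxed_law :: "nat \<Rightarrow> (nat \<Rightarrow> 's) pmf \<Rightarrow> (nat \<Rightarrow> (nat \<Rightarrow> 's) \<Rightarrow> 'a measure) \<Rightarrow>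
    (nat \<Rightarrow> 's) pmf" where
  "relaxed_law t \<mu> \<gamma> = relaxed_flow t \<mu> \<gamma> (T - t)"

definition M_relax :: "real \<Rightarrow> nat \<Rightarrow> (nat \<Rightarrow> 's) pmf \<Rightarrow> (nat \<Rightarrow> (nat \<Rightarrow> 's) \<Rightarrow> 'a measure) set" where
  "M_relax \<epsilon> t \<mu> = {\<gamma> \<in> relaxed_controls. \<forall>x\<in>stopped_paths t.
     J (relaxed_law t \<mu> \<gamma>) t x \<gamma> \<le> v (relaxed_law t \<mu> \<gamma>) t x + \<epsilon>}"

definition V_relax_eps :: "real \<Rightarrow> nat \<Rightarrow> (nat \<Rightarrow> 's) pmf \<Rightarrow> ((nat \<Rightarrow> 's) \<Rightarrow> real) set" where
  "V_relax_eps \<epsilon> t \<mu> = {\<phi> \<in> L0 t. \<exists>\<gamma>\<in>M_relax \<epsilon> t \<mu>.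
     fun_norm t (\<lambda>x. \<phi> x - J (relaxed_law t \<mu> \<gamma>) t x \<gamma>) \<le> \<epsilon>}"

definition V_relax :: "nat \<Rightarrow> (nat \<Rightarrow> 's) pmf \<Rightarrow> ((nat \<Rightarrow> 's) \<Rightarrow> real) set" where
  "V_relax t \<mu> = (\<Inter>\<epsilon>\<in>{0<..}. V_relax_eps \<epsilon> t \<mu>)"

subsection \<open>Global set value\<close>

definition Xi :: "nat \<Rightarrow> ((nat \<Rightarrow> 's) \<times> (nat \<times> (nat \<Rightarrow> 's) \<Rightarrow> 'a)) measure set" where
  "Xi t = space (prob_algebra (count_space (stopped_paths t) \<Otimes>\<^sub>M path_controls t))"

text \<open>\<open>\<integral> f(\<alpha>) \<Lambda>(x, d\<alpha>)\<close>, where \<open>\<Lambda>(x, d\<alpha>)\<close> is the (unnormalised) section of \<open>\<Lambda>\<close> at \<open>x\<close>.\<close>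

definition section_integral :: "((nat \<Rightarrow> 's) \<times> (nat \<times> (nat \<Rightarrow> 's) \<Rightarrow> 'a)) measure \<Rightarrow>
    (nat \<Rightarrow> 's) \<Rightarrow> ((nat \<times> (nat \<Rightarrow> 's) \<Rightarrow> 'a) \<Rightarrow> real) \<Rightarrow> real" where
  "section_integral \<Lambda> x f = (\<integral>z\<in>{z \<in> space \<Lambda>. fst z = x}. f (snd z) \<partial>\<Lambda>)"

text \<open>
  \<open>global_flow t \<Lambda> s\<close> is the law \<open>\<mu>\<^sup>\<Lambda>\<close> of the path stopped at time \<open>s \<ge> t\<close>.  For \<open>s = t\<close> the product is
  empty and the mass at \<open>x\<close> is the \<open>\<Lambda>\<close>-measure of \<open>x\<close> paired with all controls.  As for
  \<open>relaxed_flow\<close>, adaptedness of \<open>q\<close> allows to use the flow stopped at \<open>r\<close> at time \<open>r\<close>.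
\<close>

fun global_flow :: "nat \<Rightarrow> ((nat \<Rightarrow> 's) \<times> (nat \<times> (nat \<Rightarrow> 's) \<Rightarrow> 'a)) measure \<Rightarrow> nat \<Rightarrow>
    (nat \<Rightarrow> 's) pmf" where
  "global_flow t \<Lambda> s = embed_pmf (\<lambda>x. if x \<in> stopped_paths s then
     section_integral \<Lambda> (stop t x)
       (\<lambda>\<alpha>. \<Prod>r\<in>{t..<s}. q r x (global_flow t \<Lambda> r) (\<alpha> (r, x)) (x (Suc r)))
     else 0)"

declare global_flow.simps [simp del]

definition global_law :: "nat \<Rightarrow> ((nat \<Rightarrow> 's) \<times> (nat \<times> (nat \<Rightarrow> 's) \<Rightarrow> 'a)) measure \<Rightarrow>
    (nat \<Rightarrow> 's) pmf" where
  "global_law t \<Lambda> = global_flow t \<Lambda> T"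

definition Xi_of :: "nat \<Rightarrow> (nat \<Rightarrow> 's) pmf \<Rightarrow>
    ((nat \<Rightarrow> 's) \<times> (nat \<times> (nat \<Rightarrow> 's) \<Rightarrow> 'a)) measure set" where
  "Xi_of t \<mu> = {\<Lambda> \<in> Xi t. map_pmf (stop t) (global_law t \<Lambda>) = \<mu>}"

definition M_global :: "real \<Rightarrow> nat \<Rightarrow> (nat \<Rightarrow> 's) pmf \<Rightarrow>
    ((nat \<Rightarrow> 's) \<times> (nat \<times> (nat \<Rightarrow> 's) \<Rightarrow> 'a)) measure set" where
  "M_global \<epsilon> t \<mu> = {\<Lambda> \<in> Xi_of t \<mu>. \<forall>x\<in>stopped_paths t.
     section_integral \<Lambda> x
       (\<lambda>\<alpha>. J (global_law t \<Lambda>) t x (dirac_control \<alpha>) - v (global_law t \<Lambda>) t x) \<le> \<epsilon>}"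

definition V_global_eps :: "real \<Rightarrow> nat \<Rightarrow> (nat \<Rightarrow> 's) pmf \<Rightarrow> ((nat \<Rightarrow> 's) \<Rightarrow> real) set" where
  "V_global_eps \<epsilon> t \<mu> = {\<phi> \<in> L0 t. \<exists>\<Lambda>\<in>M_global \<epsilon> t \<mu>.
     fun_norm t (\<lambda>x. \<phi> x - v (global_law t \<Lambda>) t x) \<le> \<epsilon>}"

definition V_global :: "nat \<Rightarrow> (nat \<Rightarrow> 's) pmf \<Rightarrow> ((nat \<Rightarrow> 's) \<Rightarrow> real) set" where
  "V_global t \<mu> = (\<Inter>\<epsilon>\<in>{0<..}. V_global_eps \<epsilon> t \<mu>)"

end

subsection \<open>Data and standing assumption\<close>

definition modulus :: "(real \<Rightarrow> real) \<Rightarrow> bool" where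
  "modulus \<rho> \<longleftrightarrow> \<rho> 0 = 0 \<and> mono_on {0..} \<rho> \<and> (\<rho> \<longlongrightarrow> 0) (at_right 0)"

locale mfg = mfg_data T A q F G
  for T :: nat
    and A :: "'a::euclidean_space set"
    and q :: "nat \<Rightarrow> (nat \<Rightarrow> 's::finite) \<Rightarrow> (nat \<Rightarrow> 's) pmf \<Rightarrow> 'a \<Rightarrow> 's \<Rightarrow> real"
    and F :: "nat \<Rightarrow> (nat \<Rightarrow> 's) \<Rightarrow> (nat \<Rightarrow> 's) pmf \<Rightarrow> 'a \<Rightarrow> real"
    and G :: "(nat \<Rightarrow> 's) \<Rightarrow> (nat \<Rightarrow> 's) pmf \<Rightarrow> real" +
  fixes c_q L_q C_0 :: real and \<rho> :: "real \<Rightarrow> real"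
  assumes A_measurable: "A \<in> sets borel"
    and A_nonempty: "A \<noteq> {}"
    and q_range: "\<lbrakk>t \<le> T; x \<in> paths; \<mu> \<in> path_probs; a \<in> A\<rbrakk> \<Longrightarrow> q t x \<mu> a y \<in> {0<..<1}"
    and q_sum: "\<lbrakk>t \<le> T; x \<in> paths; \<mu> \<in> path_probs; a \<in> A\<rbrakk> \<Longrightarrow> (\<Sum>y\<in>UNIV. q t x \<mu> a y) = 1"
    and q_adapted: "\<lbrakk>t \<le> T; x \<in> paths; \<mu> \<in> path_probs; a \<in> A\<rbrakk> \<Longrightarrow>
      q t x \<mu> a y = q t (stop t x) (map_pmf (stop t) \<mu>) a y"
    and F_adapted: "\<lbrakk>t \<le> T; x \<in> paths; \<mu> \<in> path_probs; a \<in> A\<rbrakk> \<Longrightarrow>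
      F t x \<mu> a = F t (stop t x) (map_pmf (stop t) \<mu>) a"
    and c_q_pos: "c_q > 0"
    and q_lower: "\<lbrakk>t \<le> T; x \<in> paths; \<mu> \<in> path_probs; a \<in> A\<rbrakk> \<Longrightarrow> c_q \<le> q t x \<mu> a y"
    and q_Lipschitz: "\<lbrakk>t \<le> T; x \<in> paths; \<mu> \<in> path_probs; \<nu> \<in> path_probs; a \<in> A; b \<in> A\<rbrakk> \<Longrightarrow>
      \<bar>q t x \<mu> a y - q t x \<nu> b y\<bar> \<le> L_q * (W1 \<mu> \<nu> + norm (a - b))"
    and F_bounded: "\<lbrakk>t \<le> T; x \<in> paths; \<mu> \<in> path_probs; a \<in> A\<rbrakk> \<Longrightarrow> \<bar>F t x \<mu> a\<bar> \<le> C_0"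
    and G_bounded: "\<lbrakk>x \<in> paths; \<mu> \<in> path_probs\<rbrakk> \<Longrightarrow> \<bar>G x \<mu>\<bar> \<le> C_0"
    and modulus_rho: "modulus \<rho>"
    and F_continuous: "\<lbrakk>t \<le> T; x \<in> paths; \<mu> \<in> path_probs; \<nu> \<in> path_probs; a \<in> A; b \<in> A\<rbrakk> \<Longrightarrow>
      \<bar>F t x \<mu> a - F t x \<nu> b\<bar> \<le> \<rho> (W1 \<mu> \<nu> + norm (a - b))"
    and G_continuous: "\<lbrakk>x \<in> paths; \<mu> \<in> path_probs; \<nu> \<in> path_probs\<rbrakk> \<Longrightarrow>
      \<bar>G x \<mu> - G x \<nu>\<bar> \<le> \<rho> (W1 \<mu> \<nu>)"

end

theory Submission
  imports Defs
begin

text \<open>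
  From a relaxed control \<open>\<gamma>\<close> one obtains a global one by drawing the initial path from \<open>\<mu>\<close> and,
  independently, all actions \<open>\<alpha>(r, y)\<close> from \<open>\<gamma>(r, y)\<close>.  Conversely, \<open>\<Lambda>\<close> yields the relaxed control
  whose value at \<open>(r, y)\<close> is the law of \<open>\<alpha>(r, y)\<close> under the section \<open>\<Lambda>(y\<^bsub>t\<and>\<cdot>\<^esub>, d\<alpha>)\<close>, reweighted by the
  probability that \<open>\<alpha>\<close> produces \<open>y\<close> up to time \<open>r\<close>.  In both cases, since the terms of the cost
  depend on \<open>\<alpha>\<close> only through the actions along the path, the flows of measures agree and the
  \<open>\<Lambda>\<close>-integral of the regret at \<open>x\<close> is \<open>\<mu>(x)\<close> times the regret of \<open>\<gamma>\<close>.  As \<open>\<mu>\<close> is bounded below on the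
  finite set of initial paths, the two notions of approximate equilibrium coincide up to
  rescaling \<open>\<epsilon>\<close>.
\<close>

subsection \<open>Paths, controls and transitions\<close>

text \<open>A product of transition probabilities along a path does not in general factor when
  integrated over \<alpha>, since \<open>\<Lambda>\<close> may correlate the actions at different
  times. The reweighting restores the product: the weight up to \<open>Suc r\<close> is the weight
  up to \<open>r\<close> times a function of the single action at \<open>(r, y)\<close>, and the
  reweighted measure integrates that function to its mean under \<gamma>. Iterating this yields the
  path probabilities under \<gamma>. The property \<open>disintegrates\<close> records exactly this
  replacement, so that both constructions only have to verify it and the equality of laws and
  regrets is derived once. The obstacle is a circularity: the weights involve the flow of
  \<open>\<Lambda>\<close>, which is defined through \<open>embed_pmf\<close> and can be evaluated
  only once its masses are known to sum to one. Disintegration is therefore asserted conditionally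
  on the earlier flows being measures on paths, and a strong induction on time discharges this
  condition while identifying the two flows. A further mismatch is that the flows use the current
  law at each time whereas the cost freezes the terminal law; adaptedness of \<open>q\<close>
  reconciles them.\<close>

context mfg_data
begin

lemma finite_paths [simp]: "finite paths"
  unfolding paths_def by (rule finite_PiE) auto

lemma stop_in_paths [simp]: "stop s x \<in> paths"
  by (auto simp: stop_def paths_def)

lemma stop_stop: "stop r (stop s x) = stop (min r s) x"
  by (auto simp: stop_def fun_eq_iff min.assoc min.left_commute min.commute)

lemma stopped_paths_iff: "x \<in> stopped_paths s \<longleftrightarrow> x \<in> paths \<and> stop s x = x"
  unfolding stopped_paths_def by (auto simp: stop_stop image_iff intro: bexI[of _ x])

lemma stop_in_stopped_paths [simp]: "stop s x \<in> stopped_paths s"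
  by (simp add: stopped_paths_iff stop_stop)

lemma finite_stopped_paths [simp]: "finite (stopped_paths s)"
  by (simp add: stopped_paths_def)

lemma paths_nonempty: "paths \<noteq> {}"
  using stop_in_paths by blast

lemma stopped_paths_nonempty: "stopped_paths s \<noteq> {}"
  by (simp add: stopped_paths_def paths_nonempty)

lemma stopped_paths_T: "stopped_paths T = paths"
  by (auto simp: stopped_paths_iff stop_def paths_def fun_eq_iff PiE_def extensional_def)

lemma stop_cong: "(\<And>r. r \<le> s \<Longrightarrow> r \<le> T \<Longrightarrow> x r = y r) \<Longrightarrow> stop s x = stop s y"
  by (auto simp: stop_def fun_eq_iff)

lemma stop_apply: "r \<le> s \<Longrightarrow> r \<le> T \<Longrightarrow> stop s x r = x r"
  by (simp add: stop_def min_def)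

lemma extend_in_stopped_paths:
  assumes "s < T"
  shows "(\<lambda>r\<in>{..T}. if r \<le> s then x r else z) \<in> stopped_paths (Suc s)"
  using assms by (auto simp: stopped_paths_iff paths_def stop_def fun_eq_iff min_def)

lemma stop_extend: "stop s (\<lambda>r\<in>{..T}. if r \<le> s then x r else z) = stop s x"
  by (rule stop_cong) auto

text \<open>The preimage of \<open>y\<close> under the extension map is the singleton of its last
  state or empty, which is what evaluates the image law in \<open>pmf_step\<close>.\<close>

lemma extend_eq_iff:
  assumes "s < T" "y \<in> stopped_paths (Suc s)"
  shows "(\<lambda>r\<in>{..T}. if r \<le> s then x r else z) = y \<longleftrightarrow> stop s y = stop s x \<and> z = y (Suc s)"
    (is "?e = y \<longleftrightarrow> _")
proof
  assume "?e = y"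
  then show "stop s y = stop s x \<and> z = y (Suc s)"
    using stop_extend[of s x z] assms(1) by auto
next
  assume *: "stop s y = stop s x \<and> z = y (Suc s)"
  \<comment> \<open>One equation covers both the constancy of \<open>y\<close> after
    \<open>Suc s\<close> and its being undefined beyond \<open>T\<close>.\<close>
  have y: "y r = stop (Suc s) y r" for r
    using assms(2) unfolding stopped_paths_iff by (metis (no_types))
  show "?e = y"
  proof
    fix r
    show "?e r = y r"
    proof (cases "r \<le> s")
      case True
      then show ?thesis
        using * assms(1) stop_apply[of r s y] stop_apply[of r s x] by simp
    next
      case False
      then show ?thesis
        using * by (subst y) (auto simp: stop_def min_def le_Suc_eq)
    qed
  qed
qed

lemma fun_norm_le_iff: "fun_norm s \<phi> \<le> e \<longleftrightarrow> (\<forall>x\<in>stopped_paths s. \<bar>\<phi> x\<bar> \<le> e)"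
  unfolding fun_norm_def
  by (subst cSUP_le_iff) (auto simp: stopped_paths_nonempty)

text \<open>A common home for relaxed controls and for \<open>dirac_control\<close>: the latter is
  specified only at times in \<open>{t..<T}\<close> and so need not lie in
  \<open>relaxed_controls\<close>.\<close>

definition control_from :: "nat \<Rightarrow> (nat \<Rightarrow> (nat \<Rightarrow> 's) \<Rightarrow> 'a measure) \<Rightarrow> bool" where
  "control_from t \<gamma> \<longleftrightarrow> (\<forall>s\<in>{t..<T}. \<forall>x\<in>paths.
     \<gamma> s x \<in> space (prob_algebra action_space) \<and> \<gamma> s x = \<gamma> s (stop s x))"

lemma control_from_relaxed: "\<gamma> \<in> relaxed_controls \<Longrightarrow> control_from t \<gamma>"
  unfolding control_from_def relaxed_controls_def mem_Collect_eq
  by (metis atLeastLessThan_iff less_imp_le)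

lemma
  assumes "control_from t \<gamma>" "t \<le> s" "s < T" "x \<in> paths"
  shows control_from_stop: "\<gamma> s (stop s x) = \<gamma> s x"
    and control_from_prob: "\<gamma> s x \<in> space (prob_algebra action_space)"
  using assms unfolding control_from_def by (metis atLeastLessThan_iff)+

lemma control_from_prob_space:
  assumes "control_from t \<gamma>" "t \<le> s" "s < T" "x \<in> paths"
  shows "prob_space (\<gamma> s x)" "sets (\<gamma> s x) = sets action_space"
  using control_from_prob[OF assms] by (auto simp: space_prob_algebra)

lemma space_action_space [simp]: "space action_space = A"
  by (simp add: action_space_def space_restrict_space)

lemma space_path_controls:
  "space (path_controls t) = {\<alpha> \<in> ({t..<T} \<times> paths) \<rightarrow>\<^sub>E A.
     \<forall>s\<in>{t..<T}. \<forall>x\<in>paths. \<alpha> (s, x) = \<alpha> (s, stop s x)}"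
  unfolding path_controls_def space_restrict_space space_PiM space_action_space by blast

lemma path_control_in_A:
  assumes "\<alpha> \<in> space (path_controls t)" "t \<le> s" "s < T" "x \<in> paths"
  shows "\<alpha> (s, x) \<in> A"
proof -
  have "\<alpha> \<in> ({t..<T} \<times> paths) \<rightarrow>\<^sub>E A"
    using assms(1) unfolding space_path_controls mem_Collect_eq by (rule conjunct1)
  then show ?thesis
    by (rule PiE_mem) (use assms in auto)
qed

lemma path_control_stop:
  "\<alpha> \<in> space (path_controls t) \<Longrightarrow> t \<le> s \<Longrightarrow> s < T \<Longrightarrow> x \<in> paths \<Longrightarrow> \<alpha> (s, stop s x) = \<alpha> (s, x)"
  unfolding space_path_controls mem_Collect_eq by (metis atLeastLessThan_iff)

lemma control_from_dirac:
  assumes "\<alpha> \<in> space (path_controls t)"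
  shows "control_from t (dirac_control \<alpha>)"
  using path_control_in_A[OF assms] path_control_stop[OF assms]
  by (auto simp: control_from_def dirac_control_def space_prob_algebra intro!: prob_space_return)

lemma eval_measurable [measurable]:
  assumes "t \<le> s" "s < T" "x \<in> paths"
  shows "(\<lambda>\<alpha>. \<alpha> (s, x)) \<in> path_controls t \<rightarrow>\<^sub>M action_space"
  unfolding path_controls_def using assms
  by (intro measurable_restrict_space1 measurable_component_singleton) auto

end

section \<open>Regularity of the data and one-step transitions\<close>

context mfg
begin

lemma W1_refl [simp]: "W1 m m = 0"
  by (simp add: W1_def)

lemma map_stop_path_probs [simp]: "map_pmf (stop s) m \<in> path_probs"
  by (auto simp: path_probs_def)

text \<open>Adaptedness stops the path and the measure together. Applied to \<open>x\<close> and to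
  \<open>stop s x\<close> it gives the same right-hand side, which separates the two
  arguments.\<close>

lemma q_stop:
  assumes "s \<le> T" "x \<in> paths" "m \<in> path_probs" "a \<in> A"
  shows "q s (stop s x) m a y = q s x m a y"
  using q_adapted[of s x m a y] q_adapted[of s "stop s x" m a y] assms by (simp add: stop_stop)

lemma q_map_stop:
  assumes "s \<le> T" "x \<in> paths" "m \<in> path_probs" "a \<in> A"
  shows "q s x (map_pmf (stop s) m) a y = q s x m a y"
  using q_adapted[of s x m a y] q_adapted[of s x "map_pmf (stop s) m" a y] assms
  by (simp add: pmf.map_comp o_def stop_stop)

lemma F_stop:
  assumes "s \<le> T" "x \<in> paths" "m \<in> path_probs" "a \<in> A"
  shows "F s (stop s x) m a = F s x m a"
  using F_adapted[of s x m a] F_adapted[of s "stop s x" m a] assms by (simp add: stop_stop)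

lemma q_measurable:
  assumes "s \<le> T" "x \<in> paths" "m \<in> path_probs"
  shows "(\<lambda>a. q s x m a y) \<in> borel_measurable action_space"
  unfolding action_space_def
proof (rule borel_measurable_continuous_on_restrict)
  \<comment> \<open>A Lipschitz constant must be nonnegative here, while the sign of
    \<open>L_q\<close> is not among the assumptions.\<close>
  have "\<bar>L_q\<bar>-lipschitz_on A (\<lambda>a. q s x m a y)"
  proof (rule lipschitz_onI)
    fix a b assume ab: "a \<in> A" "b \<in> A"
    have "\<bar>q s x m a y - q s x m b y\<bar> \<le> L_q * norm (a - b)"
      using q_Lipschitz[of s x m m a b y] assms ab by simp
    also have "\<dots> \<le> \<bar>L_q\<bar> * norm (a - b)"
      by (intro mult_right_mono) auto
    finally show "dist (q s x m a y) (q s x m b y) \<le> \<bar>L_q\<bar> * dist a b"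
      by (simp add: dist_norm)
  qed simp
  then show "continuous_on A (\<lambda>a. q s x m a y)"
    by (rule lipschitz_on_continuous_on)
qed

lemma F_measurable:
  assumes "s \<le> T" "x \<in> paths" "m \<in> path_probs"
  shows "F s x m \<in> borel_measurable action_space"
  unfolding action_space_def
proof (rule borel_measurable_continuous_on_restrict)
  show "continuous_on A (F s x m)"
    unfolding continuous_on_iff
  proof (intro ballI allI impI)
    fix a and e :: real assume a: "a \<in> A" "e > 0"
    have "\<forall>\<^sub>F u in at_right 0. \<rho> u < e"
      using modulus_rho a(2) unfolding modulus_def by (auto intro: order_tendstoD)
    then obtain d where d: "d > 0" "\<And>u. 0 < u \<Longrightarrow> u < d \<Longrightarrow> \<rho> u < e"
      unfolding eventually_at_right_field by auto
    \<comment> \<open>The limit of the modulus at 0 from the right says nothing about the point 0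
      itself, so \<open>b = a\<close> is treated apart.\<close>
    have "dist (F s x m b) (F s x m a) < e" if "b \<in> A" "dist b a < d" for b
    proof (cases "b = a")
      case False
      have "\<bar>F s x m b - F s x m a\<bar> \<le> \<rho> (norm (b - a))"
        using F_continuous[of s x m m b a] assms a that by simp
      also have "\<dots> < e"
        using that False by (intro d) (auto simp: dist_norm)
      finally show ?thesis
        by (simp add: dist_norm)
    qed (use a in simp)
    with d show "\<exists>d>0. \<forall>b\<in>A. dist b a < d \<longrightarrow> dist (F s x m b) (F s x m a) < e"
      by blast
  qed
qed

lemma q_nonneg:
  assumes "s \<le> T" "x \<in> paths" "m \<in> path_probs" "a \<in> A"
  shows "0 \<le> q s x m a y" "q s x m a y \<le> 1"
  using q_range[OF assms, of y] by auto

lemma integrable_action: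
  fixes f :: "'a \<Rightarrow> real"
  assumes "\<nu> \<in> space (prob_algebra action_space)" "f \<in> borel_measurable action_space"
    and "\<And>a. a \<in> A \<Longrightarrow> \<bar>f a\<bar> \<le> B"
  shows "integrable \<nu> f"
proof -
  have sets: "sets \<nu> = sets action_space"
    using assms(1) by (simp add: space_prob_algebra)
  interpret prob_space \<nu>
    using assms(1) by (simp add: space_prob_algebra)
  have "f \<in> borel_measurable \<nu>"
    using assms(2) unfolding measurable_cong_sets[OF sets refl] .
  then show ?thesis
    using assms(3) sets_eq_imp_space_eq[OF sets]
    by (intro integrable_const_bound[where B = B]) auto
qed

lemma integrable_q:
  assumes "s \<le> T" "x \<in> paths" "m \<in> path_probs" "\<nu> \<in> space (prob_algebra action_space)"
  shows "integrable \<nu> (\<lambda>a. q s x m a y)"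
  using q_measurable[OF assms(1-3)] q_nonneg[OF assms(1-3)]
  by (intro integrable_action[OF assms(4), where B = 1]) auto

lemma pmf_step:
  assumes "s < T" "x \<in> paths" "m \<in> path_probs" "\<nu> \<in> space (prob_algebra action_space)"
  shows "pmf (step s x m \<nu>) y =
    (if y \<in> stopped_paths (Suc s) \<and> stop s y = stop s x then \<integral>a. q s x m a (y (Suc s)) \<partial>\<nu> else 0)"
proof -
  interpret prob_space \<nu> using assms(4) by (simp add: space_prob_algebra)
  have sets: "sets \<nu> = sets action_space" using assms(4) by (simp add: space_prob_algebra)
  then have sp: "space \<nu> = A" using sets_eq_imp_space_eq[of \<nu> action_space] by simp
  have nn: "0 \<le> (\<integral>a. q s x m a z \<partial>\<nu>)" for z
    using assms sp by (intro integral_nonneg_AE AE_I2) (auto intro: q_nonneg)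
  \<comment> \<open>The integrated kernel has to be a probability vector before
    \<open>embed_pmf\<close> can be evaluated.\<close>
  have "(\<Sum>z\<in>UNIV. \<integral>a. q s x m a z \<partial>\<nu>) = (\<integral>a. (\<Sum>z\<in>UNIV. q s x m a z) \<partial>\<nu>)"
    using assms by (subst Bochner_Integration.integral_sum) (auto intro: integrable_q)
  also have "\<dots> = (\<integral>a. 1 \<partial>\<nu>)"
    using assms sp by (intro Bochner_Integration.integral_cong) (auto simp: q_sum)
  also have "\<dots> = 1"
    by (simp add: prob_space)
  finally have sum: "(\<Sum>z\<in>UNIV. \<integral>a. q s x m a z \<partial>\<nu>) = 1" .
  have pe: "pmf (embed_pmf (\<lambda>z. \<integral>a. q s x m a z \<partial>\<nu>)) z = (\<integral>a. q s x m a z \<partial>\<nu>)" for z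
    using nn by (intro pmf_embed_pmf) (auto simp: nn_integral_count_space_finite sum_ennreal sum)
  let ?e = "\<lambda>z. \<lambda>r\<in>{..T}. if r \<le> s then x r else z"
  show ?thesis
  proof (cases "y \<in> stopped_paths (Suc s) \<and> stop s y = stop s x")
    case True
    then have "?e -` {y} = {y (Suc s)}"
      using extend_eq_iff[OF assms(1), of y x] by auto
    with True show ?thesis
      by (simp add: step_def pmf_map measure_pmf_single pe)
  next
    case False
    then have "?e -` {y} = {}"
      using extend_eq_iff[OF assms(1), of y x] extend_in_stopped_paths[OF assms(1)] by auto
    with False show ?thesis
      by (auto simp: step_def pmf_map)
  qed
qed

lemma set_pmf_step:
  assumes "s < T"
  shows "set_pmf (step s x m \<nu>) \<subseteq> stopped_paths (Suc s)"
  using extend_in_stopped_paths[OF assms] by (auto simp: step_def)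

lemma map_stop_step:
  "map_pmf (stop s) (step s x m \<nu>) = return_pmf (stop s x)"
  by (simp add: step_def pmf.map_comp o_def stop_extend)

text \<open>A path stopped at \<open>Suc s\<close> determines its predecessor
  \<open>stop s y\<close>, so the sum over intermediate paths has a single nonzero term.\<close>

lemma pmf_bind_step:
  assumes "s < T" "m \<in> path_probs" "set_pmf N \<subseteq> stopped_paths s"
    and "\<And>x. x \<in> paths \<Longrightarrow> \<gamma> s x \<in> space (prob_algebra action_space)"
    and "y \<in> stopped_paths (Suc s)"
  shows "pmf (bind_pmf N (\<lambda>x. step s x m (\<gamma> s x))) y =
    pmf N (stop s y) * (\<integral>a. q s (stop s y) m a (y (Suc s)) \<partial>\<gamma> s (stop s y))"
proof -
  have "pmf (bind_pmf N (\<lambda>x. step s x m (\<gamma> s x))) y =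
      (\<Sum>x\<in>stopped_paths s. pmf N x *\<^sub>R pmf (step s x m (\<gamma> s x)) y)"
    unfolding pmf_bind using assms(3) by (intro integral_measure_pmf) auto
  also have "\<dots> = (\<Sum>x\<in>stopped_paths s. if x = stop s y then
      pmf N (stop s y) * (\<integral>a. q s (stop s y) m a (y (Suc s)) \<partial>\<gamma> s (stop s y)) else 0)"
    using assms by (intro sum.cong refl) (auto simp: pmf_step stopped_paths_iff stop_stop)
  also have "\<dots> = pmf N (stop s y) * (\<integral>a. q s (stop s y) m a (y (Suc s)) \<partial>\<gamma> s (stop s y))"
    by (simp add: sum.delta)
  finally show ?thesis .
qed

subsection \<open>Weights of paths and the cost functional\<close>

lemma path_probs_if_stopped: "set_pmf N \<subseteq> stopped_paths s \<Longrightarrow> N \<in> path_probs"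
  by (auto simp: path_probs_def stopped_paths_iff)

lemma integral_action_cong:
  assumes "\<nu> \<in> space (prob_algebra action_space)" "\<And>a. a \<in> A \<Longrightarrow> f a = g a"
  shows "(\<integral>a. f a \<partial>\<nu>) = (\<integral>a. g a \<partial>\<nu>)"
proof (rule Bochner_Integration.integral_cong[OF refl])
  have "space \<nu> = A"
    using assms(1) sets_eq_imp_space_eq[of \<nu> action_space] by (simp add: space_prob_algebra)
  then show "f a = g a" if "a \<in> space \<nu>" for a
    using assms(2) that by simp
qed

text \<open>The probability that the stopped path \<open>y\<close> is followed from time \<open>t\<close> to time \<open>s\<close>, when the
  transition at time \<open>r\<close> uses the measure \<open>M r\<close>.\<close>

definition path_weight :: "(nat \<Rightarrow> (nat \<Rightarrow> 's) pmf) \<Rightarrow> nat \<Rightarrow> nat \<Rightarrow>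
    (nat \<Rightarrow> (nat \<Rightarrow> 's) \<Rightarrow> 'a measure) \<Rightarrow> (nat \<Rightarrow> 's) \<Rightarrow> real" where
  "path_weight M t s \<gamma> y = (\<Prod>r\<in>{t..<s}. \<integral>a. q r y (M r) a (y (Suc r)) \<partial>\<gamma> r y)"

text \<open>The path weight of one pure control, later the density by which a section of
  \<open>\<Lambda>\<close> is reweighted. The family \<open>M\<close> allows both the running flow
  and a frozen law.\<close>

definition control_weight :: "(nat \<Rightarrow> (nat \<Rightarrow> 's) pmf) \<Rightarrow> nat \<Rightarrow> nat \<Rightarrow>
    (nat \<times> (nat \<Rightarrow> 's) \<Rightarrow> 'a) \<Rightarrow> (nat \<Rightarrow> 's) \<Rightarrow> real" where
  "control_weight M t s \<alpha> y = (\<Prod>r\<in>{t..<s}. q r y (M r) (\<alpha> (r, y)) (y (Suc r)))"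

lemma path_weight_Suc:
  "t \<le> s \<Longrightarrow> path_weight M t (Suc s) \<gamma> y =
     path_weight M t s \<gamma> y * (\<integral>a. q s y (M s) a (y (Suc s)) \<partial>\<gamma> s y)"
  by (simp add: path_weight_def prod.atLeastLessThan_Suc)

lemma control_weight_Suc:
  "t \<le> s \<Longrightarrow> control_weight M t (Suc s) \<alpha> y =
     control_weight M t s \<alpha> y * q s y (M s) (\<alpha> (s, y)) (y (Suc s))"
  by (simp add: control_weight_def prod.atLeastLessThan_Suc)

lemma path_weight_self [simp]: "path_weight M t t \<gamma> y = 1"
  by (simp add: path_weight_def)

lemma control_weight_self [simp]: "control_weight M t t \<alpha> y = 1"
  by (simp add: control_weight_def)

lemma integral_q_stop:
  assumes "control_from t \<gamma>" "t \<le> r" "r < T" "r \<le> s" "y \<in> paths" "m \<in> path_probs"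
  shows "(\<integral>a. q r (stop s y) m a z \<partial>\<gamma> r (stop s y)) = (\<integral>a. q r y m a z \<partial>\<gamma> r y)"
proof -
  have 1: "\<gamma> r (stop s y) = \<gamma> r y"
    using control_from_stop[OF assms(1-3), of y] control_from_stop[OF assms(1-3), of "stop s y"] assms(4,5)
    by (simp add: stop_stop min_def)
  have 2: "q r (stop s y) m a z = q r y m a z" if "a \<in> A" for a
    using q_stop[of r y m a z] q_stop[of r "stop s y" m a z] assms that
    by (simp add: stop_stop min_def)
  show ?thesis
    unfolding 1 by (rule integral_action_cong[OF control_from_prob[OF assms(1-3,5)]]) (rule 2)
qed

lemma path_weight_stop:
  assumes "control_from t \<gamma>" "s \<le> T" "y \<in> paths" "\<And>r. t \<le> r \<Longrightarrow> r < s \<Longrightarrow> M r \<in> path_probs"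
  shows "path_weight M t s \<gamma> (stop s y) = path_weight M t s \<gamma> y"
  unfolding path_weight_def
proof (rule prod.cong[OF refl])
  fix r assume r: "r \<in> {t..<s}"
  then have "stop s y (Suc r) = y (Suc r)"
    using assms(2) by (intro stop_apply) auto
  then show "(\<integral>a. q r (stop s y) (M r) a (stop s y (Suc r)) \<partial>\<gamma> r (stop s y)) =
      (\<integral>a. q r y (M r) a (y (Suc r)) \<partial>\<gamma> r y)"
    using r assms by (simp add: integral_q_stop)
qed

lemma control_weight_stop:
  assumes "\<alpha> \<in> space (path_controls t)" "s \<le> T" "y \<in> paths"
    and "\<And>r. t \<le> r \<Longrightarrow> r < s \<Longrightarrow> M r \<in> path_probs"
  shows "control_weight M t s \<alpha> (stop s y) = control_weight M t s \<alpha> y"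
  unfolding control_weight_def
proof (rule prod.cong[OF refl])
  fix r assume r: "r \<in> {t..<s}"
  then have 1: "stop s y (Suc r) = y (Suc r)"
    using assms(2) by (intro stop_apply) auto
  have 2: "\<alpha> (r, stop s y) = \<alpha> (r, y)"
    using path_control_stop[OF assms(1), of r y] path_control_stop[OF assms(1), of r "stop s y"]
      r assms(2,3)
    by (simp add: stop_stop min_def)
  have 3: "\<alpha> (r, y) \<in> A"
    using path_control_in_A[OF assms(1)] r assms(2,3) by auto
  have "q r (stop s y) (M r) (\<alpha> (r, y)) z = q r y (M r) (\<alpha> (r, y)) z" for z
    using q_stop[of r y "M r" "\<alpha> (r, y)" z] q_stop[of r "stop s y" "M r" "\<alpha> (r, y)" z] assms r 3
    by (simp add: stop_stop min_def)
  then show "q r (stop s y) (M r) (\<alpha> (r, stop s y)) (stop s y (Suc r)) =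
      q r y (M r) (\<alpha> (r, y)) (y (Suc r))"
    by (simp add: 1 2)
qed

lemma path_weight_dirac:
  assumes "\<alpha> \<in> space (path_controls t)" "s \<le> T" "y \<in> paths"
    and "\<And>r. t \<le> r \<Longrightarrow> r < s \<Longrightarrow> M r \<in> path_probs"
  shows "path_weight M t s (dirac_control \<alpha>) y = control_weight M t s \<alpha> y"
  unfolding path_weight_def control_weight_def dirac_control_def
  using assms path_control_in_A[OF assms(1)]
  by (intro prod.cong refl integral_return q_measurable) auto

lemma control_weight_bounds:
  assumes "\<alpha> \<in> space (path_controls t)" "s \<le> T" "y \<in> paths"
    and "\<And>r. t \<le> r \<Longrightarrow> r < s \<Longrightarrow> M r \<in> path_probs"
  shows "0 \<le> control_weight M t s \<alpha> y" "control_weight M t s \<alpha> y \<le> 1"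
  unfolding control_weight_def
  using assms path_control_in_A[OF assms(1)]
  by (auto intro!: prod_nonneg prod_le_1 q_nonneg)

lemma control_weight_measurable:
  assumes "s \<le> T" "y \<in> paths" "\<And>r. t \<le> r \<Longrightarrow> r < s \<Longrightarrow> M r \<in> path_probs"
  shows "(\<lambda>\<alpha>. control_weight M t s \<alpha> y) \<in> borel_measurable (path_controls t)"
  unfolding control_weight_def
proof (rule borel_measurable_prod)
  fix r assume r: "r \<in> {t..<s}"
  show "(\<lambda>\<alpha>. q r y (M r) (\<alpha> (r, y)) (y (Suc r))) \<in> borel_measurable (path_controls t)"
    by (rule measurable_compose[OF eval_measurable q_measurable]) (use r assms in auto)
qed

text \<open>The bridge between the running flow, which drives \<open>global_flow\<close>, and the
  terminal law, which enters the cost: at time \<open>r\<close> the transition sees \<open>m\<close>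
  only through its image under \<open>stop r\<close>.\<close>

lemma control_weight_cong_flow:
  assumes "\<alpha> \<in> space (path_controls t)" "s \<le> T" "y \<in> paths" "m \<in> path_probs"
    and "\<And>r. t \<le> r \<Longrightarrow> r < s \<Longrightarrow> M r = map_pmf (stop r) m"
  shows "control_weight M t s \<alpha> y = control_weight (\<lambda>_. m) t s \<alpha> y"
  unfolding control_weight_def
  using assms path_control_in_A[OF assms(1)]
  by (intro prod.cong refl) (auto simp: q_map_stop)

section \<open>Supports, consistency and product formulas of the stopped laws\<close>

lemma map_stop_id: "set_pmf N \<subseteq> stopped_paths s \<Longrightarrow> map_pmf (stop s) N = N"
  by (subst map_pmf_cong[of N N "stop s" id]) (auto simp: stopped_paths_iff)

lemma map_stop_bind_step:
  assumes "set_pmf N \<subseteq> stopped_paths s"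
  shows "map_pmf (stop s) (bind_pmf N (\<lambda>x. step s x m (\<gamma> s x))) = N"
  by (simp add: map_bind_pmf map_stop_step map_stop_id[OF assms] flip: map_pmf_def)

lemma set_pmf_bind_step:
  "s < T \<Longrightarrow> set_pmf (bind_pmf N (\<lambda>x. step s x m (\<gamma> s x))) \<subseteq> stopped_paths (Suc s)"
  using set_pmf_step by (fastforce simp: set_bind_pmf)

text \<open>A case distinction replaces induction: a step lands in the stopped paths whatever law
  precedes it.\<close>

lemma set_pmf_law:
  "x \<in> stopped_paths t \<Longrightarrow> t + k \<le> T \<Longrightarrow> set_pmf (law m t x \<gamma> k) \<subseteq> stopped_paths (t + k)"
  using set_pmf_bind_step[of "t + (k - 1)"] by (cases k) auto

lemma set_pmf_flow:
  "set_pmf \<mu> \<subseteq> stopped_paths t \<Longrightarrow> t + k \<le> T \<Longrightarrow>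
    set_pmf (relaxed_flow t \<mu> \<gamma> k) \<subseteq> stopped_paths (t + k)"
  using set_pmf_bind_step[of "t + (k - 1)"] by (cases k) auto

lemma map_stop_law:
  assumes "x \<in> stopped_paths t" "t + k + j \<le> T"
  shows "map_pmf (stop (t + k)) (law m t x \<gamma> (k + j)) = law m t x \<gamma> k"
  using assms(2)
proof (induction j)
  case 0
  then show ?case
    using set_pmf_law[OF assms(1), of k] by (simp add: map_stop_id)
next
  case (Suc j)
  have "map_pmf (stop (t + k)) (law m t x \<gamma> (k + Suc j)) =
      map_pmf (stop (t + k)) (map_pmf (stop (t + (k + j))) (law m t x \<gamma> (k + Suc j)))"
    by (simp add: pmf.map_comp o_def stop_stop)
  also have "map_pmf (stop (t + (k + j))) (law m t x \<gamma> (k + Suc j)) = law m t x \<gamma> (k + j)"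
    using set_pmf_law[OF assms(1), of "k + j"] Suc.prems
    by (simp add: map_stop_bind_step)
  finally show ?case
    using Suc by simp
qed

lemma map_stop_flow:
  assumes "set_pmf \<mu> \<subseteq> stopped_paths t" "t + k + j \<le> T"
  shows "map_pmf (stop (t + k)) (relaxed_flow t \<mu> \<gamma> (k + j)) = relaxed_flow t \<mu> \<gamma> k"
  using assms(2)
proof (induction j)
  case 0
  then show ?case
    using set_pmf_flow[OF assms(1), of k] by (simp add: map_stop_id)
next
  case (Suc j)
  have "map_pmf (stop (t + k)) (relaxed_flow t \<mu> \<gamma> (k + Suc j)) =
      map_pmf (stop (t + k)) (map_pmf (stop (t + (k + j))) (relaxed_flow t \<mu> \<gamma> (k + Suc j)))"
    by (simp add: pmf.map_comp o_def stop_stop)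
  also have "map_pmf (stop (t + (k + j))) (relaxed_flow t \<mu> \<gamma> (k + Suc j)) = relaxed_flow t \<mu> \<gamma> (k + j)"
    using set_pmf_flow[OF assms(1), of "k + j"] Suc.prems
    by (simp add: map_stop_bind_step)
  finally show ?case
    using Suc by simp
qed

text \<open>Each step contributes one transition factor, and stopping \<open>y\<close> at the
  previous time changes none of the earlier factors.\<close>

lemma pmf_law:
  assumes "control_from t \<gamma>" "m \<in> path_probs" "x \<in> stopped_paths t"
    and "t + k \<le> T" "y \<in> stopped_paths (t + k)"
  shows "pmf (law m t x \<gamma> k) y = (if stop t y = x then path_weight (\<lambda>_. m) t (t + k) \<gamma> y else 0)"
  using assms(4,5)
proof (induction k arbitrary: y)
  case 0
  then show ?case
    by (auto simp: stopped_paths_iff indicator_def)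
next
  case (Suc k)
  have y: "y \<in> paths"
    using Suc.prems by (simp add: stopped_paths_iff)
  have "pmf (law m t x \<gamma> (Suc k)) y = pmf (law m t x \<gamma> k) (stop (t + k) y) *
      (\<integral>a. q (t + k) (stop (t + k) y) m a (y (Suc (t + k))) \<partial>\<gamma> (t + k) (stop (t + k) y))"
    unfolding law.simps using Suc.prems assms set_pmf_law[OF assms(3), of k]
    by (intro pmf_bind_step control_from_prob) auto
  also have "pmf (law m t x \<gamma> k) (stop (t + k) y) =
      (if stop t y = x then path_weight (\<lambda>_. m) t (t + k) \<gamma> y else 0)"
    using Suc.prems assms y by (subst Suc.IH) (auto simp: stop_stop path_weight_stop)
  also have "(\<integral>a. q (t + k) (stop (t + k) y) m a (y (Suc (t + k))) \<partial>\<gamma> (t + k) (stop (t + k) y)) =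
      (\<integral>a. q (t + k) y m a (y (Suc (t + k))) \<partial>\<gamma> (t + k) y)"
    using Suc.prems assms y by (intro integral_q_stop) auto
  finally show ?case
    by (simp add: path_weight_Suc)
qed

text \<open>The flow enters its own transitions only through earlier times, so the product formula
  holds with the flow itself as \<open>M\<close>. The shift \<open>r - t\<close> converts absolute
  time into the elapsed time that indexes \<open>relaxed_flow\<close>.\<close>

lemma pmf_flow:
  assumes "control_from t \<gamma>" "set_pmf \<mu> \<subseteq> stopped_paths t"
    and "t + k \<le> T" "y \<in> stopped_paths (t + k)"
  shows "pmf (relaxed_flow t \<mu> \<gamma> k) y =
    pmf \<mu> (stop t y) * path_weight (\<lambda>r. relaxed_flow t \<mu> \<gamma> (r - t)) t (t + k) \<gamma> y"
  using assms(3,4)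
proof (induction k arbitrary: y)
  case 0
  then show ?case
    by (auto simp: stopped_paths_iff)
next
  case (Suc k)
  let ?M = "\<lambda>r. relaxed_flow t \<mu> \<gamma> (r - t)"
  have y: "y \<in> paths"
    using Suc.prems by (simp add: stopped_paths_iff)
  have M: "?M r \<in> path_probs" if "t \<le> r" "r \<le> T" for r
    using set_pmf_flow[OF assms(2), of "r - t"] that path_probs_if_stopped[of _ r] by simp
  have "pmf (relaxed_flow t \<mu> \<gamma> (Suc k)) y = pmf (relaxed_flow t \<mu> \<gamma> k) (stop (t + k) y) *
      (\<integral>a. q (t + k) (stop (t + k) y) (?M (t + k)) a (y (Suc (t + k))) \<partial>\<gamma> (t + k) (stop (t + k) y))"
    unfolding relaxed_flow.simps using Suc.prems assms set_pmf_flow[OF assms(2), of k] M[of "t + k"]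
    by (subst pmf_bind_step) (auto intro!: control_from_prob)
  also have "pmf (relaxed_flow t \<mu> \<gamma> k) (stop (t + k) y) =
      pmf \<mu> (stop t y) * path_weight ?M t (t + k) \<gamma> y"
    using Suc.prems assms y M by (subst Suc.IH) (auto simp: stop_stop path_weight_stop)
  also have "(\<integral>a. q (t + k) (stop (t + k) y) (?M (t + k)) a (y (Suc (t + k))) \<partial>\<gamma> (t + k) (stop (t + k) y)) =
      (\<integral>a. q (t + k) y (?M (t + k)) a (y (Suc (t + k))) \<partial>\<gamma> (t + k) y)"
    using Suc.prems assms y M[of "t + k"] by (intro integral_q_stop) auto
  finally show ?case
    by (simp add: path_weight_Suc)
qed

section \<open>The cost as a sum over stopped paths\<close>

lemma expectation_stopped:
  fixes f :: "(nat \<Rightarrow> 's) \<Rightarrow> real"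
  assumes "set_pmf N \<subseteq> stopped_paths s"
  shows "measure_pmf.expectation N f = (\<Sum>y\<in>stopped_paths s. pmf N y * f y)"
  using assms by (subst integral_measure_pmf[of "stopped_paths s"]) auto

text \<open>The running cost at time \<open>r\<close> depends on the path only up to
  \<open>r\<close>, so its expectation can be taken under the law stopped at \<open>r\<close>. Each
  term then carries the weight up to \<open>r\<close> and no later factor, the form required by
  \<open>disintegrates\<close>.\<close>

lemma J_eq:
  assumes "control_from t \<gamma>" "m \<in> path_probs" "x \<in> stopped_paths t" "t \<le> T"
  shows "J m t x \<gamma> = (\<Sum>y\<in>stopped_paths T. pmf (law m t x \<gamma> (T - t)) y * G y m) +
    (\<Sum>r\<in>{t..<T}. \<Sum>y\<in>stopped_paths r. pmf (law m t x \<gamma> (r - t)) y * (\<integral>a. F r y m a \<partial>\<gamma> r y))"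
proof -
  let ?N = "law m t x \<gamma> (T - t)"
  have N: "set_pmf ?N \<subseteq> stopped_paths T"
    using set_pmf_law[OF assms(3), of "T - t"] assms(4) by simp
  have int: "integrable ?N h" for h :: "(nat \<Rightarrow> 's) \<Rightarrow> real"
    using N by (intro integrable_measure_pmf_finite) (rule finite_subset, auto)
  have "measure_pmf.expectation ?N (\<lambda>y. \<integral>a. F r y m a \<partial>\<gamma> r y) =
      (\<Sum>y\<in>stopped_paths r. pmf (law m t x \<gamma> (r - t)) y * (\<integral>a. F r y m a \<partial>\<gamma> r y))"
    if r: "r \<in> {t..<T}" for r
  proof -
    have "measure_pmf.expectation ?N (\<lambda>y. \<integral>a. F r y m a \<partial>\<gamma> r y) =
        measure_pmf.expectation ?N (\<lambda>y. \<integral>a. F r (stop r y) m a \<partial>\<gamma> r (stop r y))"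
    proof (rule integral_cong_AE)
      show "AE y in ?N. (\<integral>a. F r y m a \<partial>\<gamma> r y) = (\<integral>a. F r (stop r y) m a \<partial>\<gamma> r (stop r y))"
      proof (rule AE_pmfI)
        fix y assume "y \<in> set_pmf ?N"
        then have y: "y \<in> paths"
          using N by (auto simp: stopped_paths_iff)
        have eq: "\<gamma> r (stop r y) = \<gamma> r y"
          using control_from_stop[OF assms(1), of r y] r y by simp
        show "(\<integral>a. F r y m a \<partial>\<gamma> r y) = (\<integral>a. F r (stop r y) m a \<partial>\<gamma> r (stop r y))"
          unfolding eq using r y assms(2) control_from_prob[OF assms(1), of r y]
          by (intro integral_action_cong) (auto simp: F_stop)
      qed
    qed auto
    also have "\<dots> = measure_pmf.expectation (map_pmf (stop r) ?N) (\<lambda>y. \<integral>a. F r y m a \<partial>\<gamma> r y)"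
      by simp
    also have "map_pmf (stop r) ?N = law m t x \<gamma> (r - t)"
      using map_stop_law[OF assms(3), of "r - t" "T - r"] r by simp
    also have "measure_pmf.expectation (law m t x \<gamma> (r - t)) (\<lambda>y. \<integral>a. F r y m a \<partial>\<gamma> r y) =
      (\<Sum>y\<in>stopped_paths r. pmf (law m t x \<gamma> (r - t)) y * (\<integral>a. F r y m a \<partial>\<gamma> r y))"
      using set_pmf_law[OF assms(3), of "r - t"] r by (intro expectation_stopped) auto
    finally show ?thesis .
  qed
  then show ?thesis
    unfolding J_def using N
    by (simp add: Bochner_Integration.integral_add Bochner_Integration.integral_sum int expectation_stopped)
qed

lemma C_0_nonneg: "0 \<le> C_0"
proof -
  obtain x where x: "x \<in> paths"
    using paths_nonempty by auto
  then have "\<bar>G x (return_pmf x)\<bar> \<le> C_0"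
    by (intro G_bounded) (auto simp: path_probs_def)
  then show ?thesis
    by linarith
qed

text \<open>Makes the real infimum that defines \<open>v\<close> a genuine lower bound, as
  \<open>v_le_J\<close> requires.\<close>

lemma J_bounded:
  assumes "control_from t \<gamma>" "m \<in> path_probs" "x \<in> stopped_paths t" "t \<le> T"
  shows "\<bar>J m t x \<gamma>\<bar> \<le> C_0 + real (T - t) * C_0"
proof -
  have F: "\<bar>\<integral>a. F r y m a \<partial>\<gamma> r y\<bar> \<le> C_0" if r: "r \<in> {t..<T}" and y: "y \<in> paths" for r y
  proof -
    have \<gamma>: "\<gamma> r y \<in> space (prob_algebra action_space)"
      using control_from_prob[OF assms(1)] r y by auto
    then interpret prob_space "\<gamma> r y"
      by (simp add: space_prob_algebra)
    have sp: "space (\<gamma> r y) = A"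
      using \<gamma> sets_eq_imp_space_eq[of "\<gamma> r y" action_space] by (simp add: space_prob_algebra)
    have "norm (\<integral>a. F r y m a \<partial>\<gamma> r y) \<le> (\<integral>a. C_0 \<partial>\<gamma> r y)"
      using F_bounded[of r y m] F_measurable[of r y m] C_0_nonneg assms(2) r y sp
      by (intro Bochner_Integration.integral_norm_bound_integral integrable_action[OF \<gamma>, of _ C_0]) auto
    then show ?thesis
      by (simp add: prob_space)
  qed
  let ?N = "law m t x \<gamma> (T - t)"
  have N: "set_pmf ?N \<subseteq> paths"
    using set_pmf_law[OF assms(3), of "T - t"] assms(4) by (simp add: stopped_paths_T)
  then have int: "integrable ?N h" for h :: "(nat \<Rightarrow> 's) \<Rightarrow> real"
    by (intro integrable_measure_pmf_finite) (rule finite_subset, auto)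
  let ?h = "\<lambda>y. G y m + (\<Sum>r = t..<T. \<integral>a. F r y m a \<partial>\<gamma> r y)"
  have "\<bar>J m t x \<gamma>\<bar> \<le> measure_pmf.expectation ?N (\<lambda>y. \<bar>?h y\<bar>)"
    unfolding J_def by (rule integral_abs_bound)
  also have "\<dots> \<le> measure_pmf.expectation ?N (\<lambda>y. C_0 + real (T - t) * C_0)"
  proof (intro integral_mono_AE int AE_pmfI)
    fix y assume "y \<in> set_pmf ?N"
    then have y: "y \<in> paths" using N by auto
    have "\<bar>\<Sum>r = t..<T. \<integral>a. F r y m a \<partial>\<gamma> r y\<bar> \<le> (\<Sum>r = t..<T. C_0)"
      using F y by (intro order_trans[OF sum_abs] sum_mono) auto
    then show "\<bar>?h y\<bar> \<le> C_0 + real (T - t) * C_0"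
      using G_bounded[OF y assms(2)] by simp
  qed
  finally show ?thesis
    by simp
qed

lemma v_le_J:
  assumes "\<gamma> \<in> relaxed_controls" "m \<in> path_probs" "x \<in> stopped_paths t" "t \<le> T"
  shows "v m t x \<le> J m t x \<gamma>"
  unfolding v_def
proof (rule cINF_lower[OF _ assms(1)])
  show "bdd_below (J m t x ` relaxed_controls)"
  proof (rule bdd_belowI2)
    fix \<gamma> assume "\<gamma> \<in> relaxed_controls"
    then show "- (C_0 + real (T - t) * C_0) \<le> J m t x \<gamma>"
      using J_bounded[OF control_from_relaxed assms(2-4), of \<gamma>] unfolding abs_le_iff by linarith
  qed
qed

subsection \<open>Sections of a global control and their disintegration\<close>

text \<open>Turns \<open>section_integral\<close> into an ordinary integral over the controls. It is
  left unnormalised, with mass equal to the initial mass at \<open>x\<close>, so null sections need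
  no separate definition.\<close>

definition section_measure :: "nat \<Rightarrow> ((nat \<Rightarrow> 's) \<times> (nat \<times> (nat \<Rightarrow> 's) \<Rightarrow> 'a)) measure \<Rightarrow>
    (nat \<Rightarrow> 's) \<Rightarrow> (nat \<times> (nat \<Rightarrow> 's) \<Rightarrow> 'a) measure" where
  "section_measure t \<Lambda> x =
     distr (restrict_space \<Lambda> {z \<in> space \<Lambda>. fst z = x}) (path_controls t) snd"

lemma sets_section_measure [simp, measurable_cong]:
  "sets (section_measure t \<Lambda> x) = sets (path_controls t)"
  by (simp add: section_measure_def)

lemma space_section_measure [simp]: "space (section_measure t \<Lambda> x) = space (path_controls t)"
  by (simp add: section_measure_def)

lemma
  assumes "\<Lambda> \<in> Xi t"
  shows Xi_prob_space: "prob_space \<Lambda>"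
    and Xi_sets: "sets \<Lambda> = sets (count_space (stopped_paths t) \<Otimes>\<^sub>M path_controls t)"
  using assms by (auto simp: Xi_def space_prob_algebra)

lemma Xi_space: "\<Lambda> \<in> Xi t \<Longrightarrow> space \<Lambda> = stopped_paths t \<times> space (path_controls t)"
  using sets_eq_imp_space_eq[OF Xi_sets] by (auto simp: space_pair_measure)

lemma section_in_sets:
  assumes "\<Lambda> \<in> Xi t" "x \<in> stopped_paths t"
  shows "{z \<in> space \<Lambda>. fst z = x} \<in> sets \<Lambda>"
proof -
  have "{z \<in> space \<Lambda>. fst z = x} = {x} \<times> space (path_controls t)"
    using assms by (auto simp: Xi_space)
  also have "\<dots> \<in> sets \<Lambda>"
    unfolding Xi_sets[OF assms(1)] using assms(2) by (intro pair_measureI) auto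
  finally show ?thesis .
qed

lemma snd_measurable_restrict:
  assumes "\<Lambda> \<in> Xi t"
  shows "snd \<in> restrict_space \<Lambda> S \<rightarrow>\<^sub>M path_controls t"
  using Xi_sets[OF assms]
  by (intro measurable_restrict_space1) (simp cong: measurable_cong_sets)

lemma section_integral_eq:
  assumes "\<Lambda> \<in> Xi t" "x \<in> stopped_paths t" "f \<in> borel_measurable (path_controls t)"
  shows "section_integral \<Lambda> x f = (\<integral>\<alpha>. f \<alpha> \<partial>section_measure t \<Lambda> x)"
proof -
  have "(\<integral>\<alpha>. f \<alpha> \<partial>section_measure t \<Lambda> x) =
      (\<integral>z. f (snd z) \<partial>restrict_space \<Lambda> {z \<in> space \<Lambda>. fst z = x})"
    unfolding section_measure_def
    by (rule integral_distr[OF snd_measurable_restrict[OF assms(1)] assms(3)])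
  also have "\<dots> = section_integral \<Lambda> x f"
    unfolding section_integral_def set_lebesgue_integral_def
    using section_in_sets[OF assms(1,2)] by (intro integral_restrict_space) auto
  finally show ?thesis
    by simp
qed

lemma finite_measure_section:
  assumes "\<Lambda> \<in> Xi t" "x \<in> stopped_paths t"
  shows "finite_measure (section_measure t \<Lambda> x)"
proof -
  interpret prob_space \<Lambda>
    by (rule Xi_prob_space[OF assms(1)])
  interpret R: finite_measure "restrict_space \<Lambda> {z \<in> space \<Lambda>. fst z = x}"
    by (rule finite_measure_restrict_space[OF finite_measure_axioms section_in_sets[OF assms]])
  show ?thesis
    unfolding section_measure_def
    by (rule R.finite_measure_distr[OF snd_measurable_restrict[OF assms(1)]])
qed

lemma measure_section:
  assumes "\<Lambda> \<in> Xi t" "x \<in> stopped_paths t"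
  shows "measure (section_measure t \<Lambda> x) (space (path_controls t)) =
    measure \<Lambda> {z \<in> space \<Lambda>. fst z = x}"
proof -
  have "measure (section_measure t \<Lambda> x) (space (path_controls t)) =
      measure (restrict_space \<Lambda> {z \<in> space \<Lambda>. fst z = x})
        (space (restrict_space \<Lambda> {z \<in> space \<Lambda>. fst z = x}))"
    unfolding section_measure_def
    using snd_measurable_restrict[OF assms(1), of "{z \<in> space \<Lambda>. fst z = x}"]
    by (subst measure_distr) (auto intro!: arg_cong2[where f = measure] dest: measurable_space)
  also have "\<dots> = measure \<Lambda> {z \<in> space \<Lambda>. fst z = x}"
    using section_in_sets[OF assms] by (subst measure_restrict_space) (auto simp: space_restrict_space)
  finally show ?thesis .
qed

lemma sum_measure_section:
  assumes "\<Lambda> \<in> Xi t"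
  shows "(\<Sum>x\<in>stopped_paths t. measure (section_measure t \<Lambda> x) (space (path_controls t))) = 1"
proof -
  interpret prob_space \<Lambda>
    by (rule Xi_prob_space[OF assms(1)])
  have "(\<Sum>x\<in>stopped_paths t. measure (section_measure t \<Lambda> x) (space (path_controls t))) =
      (\<Sum>x\<in>stopped_paths t. prob {z \<in> space \<Lambda>. fst z = x})"
    by (simp add: measure_section[OF assms])
  also have "\<dots> = prob (\<Union>x\<in>stopped_paths t. {z \<in> space \<Lambda>. fst z = x})"
    using section_in_sets[OF assms]
    by (intro finite_measure_finite_Union[symmetric]) (auto simp: disjoint_family_on_def)
  also have "(\<Union>x\<in>stopped_paths t. {z \<in> space \<Lambda>. fst z = x}) = space \<Lambda>"
    by (auto simp: Xi_space[OF assms])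
  finally show ?thesis
    by (simp add: prob_space)
qed

lemma integrable_control:
  fixes f :: "(nat \<times> (nat \<Rightarrow> 's) \<Rightarrow> 'a) \<Rightarrow> real"
  assumes "finite_measure \<nu>" "sets \<nu> = sets (path_controls t)"
    and "f \<in> borel_measurable (path_controls t)"
    and "\<And>\<alpha>. \<alpha> \<in> space (path_controls t) \<Longrightarrow> \<bar>f \<alpha>\<bar> \<le> B"
  shows "integrable \<nu> f"
proof -
  interpret finite_measure \<nu> by (rule assms(1))
  have "f \<in> borel_measurable \<nu>"
    using assms(3) unfolding measurable_cong_sets[OF assms(2) refl] .
  then show ?thesis
    using assms(4) sets_eq_imp_space_eq[OF assms(2)]
    by (intro integrable_const_bound[where B = B]) auto
qed

text \<open>The relaxed control \<open>\<gamma>\<close> is the conditional law, under \<open>\<nu>\<close>, of the action chosen at time \<open>r\<close>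
  given that the path \<open>y\<close> has been followed up to \<open>r\<close>.\<close>

definition disintegrates :: "(nat \<Rightarrow> (nat \<Rightarrow> 's) pmf) \<Rightarrow> nat \<Rightarrow> nat \<Rightarrow> (nat \<Rightarrow> 's) \<Rightarrow>
    (nat \<Rightarrow> (nat \<Rightarrow> 's) \<Rightarrow> 'a measure) \<Rightarrow> (nat \<times> (nat \<Rightarrow> 's) \<Rightarrow> 'a) measure \<Rightarrow> bool" where
  "disintegrates M t s x \<gamma> \<nu> \<longleftrightarrow>
     (\<forall>r\<in>{t..<s}. \<forall>y\<in>stopped_paths r. stop t y = x \<longrightarrow>
       (\<forall>f\<in>borel_measurable action_space. (\<exists>B. \<forall>a\<in>A. \<bar>f a\<bar> \<le> B) \<longrightarrow>
         (\<integral>\<alpha>. control_weight M t r \<alpha> y * f (\<alpha> (r, y)) \<partial>\<nu>) =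
         (\<integral>\<alpha>. control_weight M t r \<alpha> y \<partial>\<nu>) * (\<integral>a. f a \<partial>\<gamma> r y)))"

lemma disintegratesD:
  fixes f :: "'a \<Rightarrow> real"
  assumes "disintegrates M t s x \<gamma> \<nu>" "t \<le> r" "r < s" "y \<in> stopped_paths r" "stop t y = x"
    and "f \<in> borel_measurable action_space" "\<And>a. a \<in> A \<Longrightarrow> \<bar>f a\<bar> \<le> B"
  shows "(\<integral>\<alpha>. control_weight M t r \<alpha> y * f (\<alpha> (r, y)) \<partial>\<nu>) =
         (\<integral>\<alpha>. control_weight M t r \<alpha> y \<partial>\<nu>) * (\<integral>a. f a \<partial>\<gamma> r y)"
  using assms(1)[unfolded disintegrates_def, rule_format, OF _ assms(4-6)] assms(2,3,7) by fastforce

text \<open>Peeling off the last factor leaves a weight times a function of one action;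
  disintegration replaces that function by its mean under \<gamma>. By induction the integral of the
  product becomes a product of means, even though the actions may be correlated under \<nu>.\<close>

lemma integral_control_weight:
  assumes "finite_measure \<nu>" "sets \<nu> = sets (path_controls t)" "control_from t \<gamma>" "s \<le> T"
    and "\<And>r. t \<le> r \<Longrightarrow> r < s \<Longrightarrow> M r \<in> path_probs"
    and "disintegrates M t s x \<gamma> \<nu>" "t \<le> r" "r \<le> s" "y \<in> stopped_paths r" "stop t y = x"
  shows "(\<integral>\<alpha>. control_weight M t r \<alpha> y \<partial>\<nu>) = measure \<nu> (space \<nu>) * path_weight M t r \<gamma> y"
  using assms(7-10)
proof (induction r arbitrary: y rule: dec_induct)
  case base
  then show ?case
    by simp
next
  case (step r)
  have y: "y \<in> paths"
    using step.prems by (simp add: stopped_paths_iff)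
  \<comment> \<open>\<open>disintegrates\<close> speaks at time \<open>r\<close> about paths stopped
    at \<open>r\<close>, while \<open>y\<close> is stopped one step later.\<close>
  let ?y = "stop r y"
  let ?f = "\<lambda>a. q r y (M r) a (y (Suc r))"
  have space: "space \<nu> = space (path_controls t)"
    by (rule sets_eq_imp_space_eq[OF assms(2)])
  have "(\<integral>\<alpha>. control_weight M t (Suc r) \<alpha> y \<partial>\<nu>) =
      (\<integral>\<alpha>. control_weight M t r \<alpha> ?y * ?f (\<alpha> (r, ?y)) \<partial>\<nu>)"
  proof (rule Bochner_Integration.integral_cong[OF refl])
    fix \<alpha> assume "\<alpha> \<in> space \<nu>"
    then show "control_weight M t (Suc r) \<alpha> y = control_weight M t r \<alpha> ?y * ?f (\<alpha> (r, ?y))"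
      using step assms(4,5) y path_control_stop[of \<alpha> t r y] control_weight_stop[of \<alpha> t r y M]
      by (simp add: space control_weight_Suc)
  qed
  also have "\<dots> = (\<integral>\<alpha>. control_weight M t r \<alpha> ?y \<partial>\<nu>) * (\<integral>a. ?f a \<partial>\<gamma> r ?y)"
    using step assms(4,5) y q_nonneg[of r y "M r"]
    by (intro disintegratesD[OF assms(6), of _ _ _ 1] q_measurable) (auto simp: stop_stop min_def)
  also have "(\<integral>\<alpha>. control_weight M t r \<alpha> ?y \<partial>\<nu>) = measure \<nu> (space \<nu>) * path_weight M t r \<gamma> y"
    using step assms(3,4,5) y by (subst step.IH) (auto simp: stop_stop min_def path_weight_stop)
  also have "\<gamma> r ?y = \<gamma> r y"
    using control_from_stop[OF assms(3)] step assms(4) y by auto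
  finally show ?case
    using step by (simp add: path_weight_Suc)
qed

text \<open>Every term involves \<alpha> only through a weight up to some \<open>r\<close> and at
  most the action at that same \<open>r\<close>, so it can be integrated term by term.\<close>

lemma J_dirac:
  assumes "\<alpha> \<in> space (path_controls t)" "m \<in> path_probs" "x \<in> stopped_paths t" "t \<le> T"
  shows "J m t x (dirac_control \<alpha>) =
    (\<Sum>y\<in>stopped_paths T. (if stop t y = x then control_weight (\<lambda>_. m) t T \<alpha> y else 0) * G y m) +
    (\<Sum>r\<in>{t..<T}. \<Sum>y\<in>stopped_paths r.
       if stop t y = x then control_weight (\<lambda>_. m) t r \<alpha> y * F r y m (\<alpha> (r, y)) else 0)"
proof -
  note c = control_from_dirac[OF assms(1)]
  have law: "pmf (law m t x (dirac_control \<alpha>) (r - t)) y =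
      (if stop t y = x then control_weight (\<lambda>_. m) t r \<alpha> y else 0)"
    if "t \<le> r" "r \<le> T" "y \<in> stopped_paths r" for r y
    using pmf_law[OF c assms(2,3), of "r - t" y] path_weight_dirac[OF assms(1), of r y "\<lambda>_. m"]
      that assms(2) by (auto simp: stopped_paths_iff)
  have F: "(\<integral>a. F r y m a \<partial>dirac_control \<alpha> r y) = F r y m (\<alpha> (r, y))"
    if "t \<le> r" "r < T" "y \<in> stopped_paths r" for r y
    unfolding dirac_control_def
    using that assms(2) path_control_in_A[OF assms(1), of r y]
    by (intro integral_return F_measurable) (auto simp: stopped_paths_iff)
  show ?thesis
    unfolding J_eq[OF c assms(2-4)]
    using assms(4) by (intro arg_cong2[where f = "(+)"] sum.cong refl) (auto simp: law F)
qed

text \<open>Linear in the terms of \<open>J_dirac\<close>: disintegration averages the running cost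
  under \<gamma>, and \<open>integral_control_weight\<close> turns the remaining weight into a
  probability under \<open>law\<close>. Integrability is recorded because a constant is later
  subtracted under the integral.\<close>

lemma
  assumes "finite_measure \<nu>" "sets \<nu> = sets (path_controls t)" "control_from t \<gamma>" "t \<le> T"
    and "m \<in> path_probs" "x \<in> stopped_paths t" "disintegrates (\<lambda>_. m) t T x \<gamma> \<nu>"
  shows J_dirac_integrable: "integrable \<nu> (\<lambda>\<alpha>. J m t x (dirac_control \<alpha>))"
    and integral_J_dirac:
      "(\<integral>\<alpha>. J m t x (dirac_control \<alpha>) \<partial>\<nu>) = measure \<nu> (space \<nu>) * J m t x \<gamma>"
proof -
  let ?w = "\<lambda>r \<alpha> y. control_weight (\<lambda>_. m) t r \<alpha> y"
  let ?c = "measure \<nu> (space \<nu>)"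
  let ?g = "\<lambda>\<alpha>. (\<Sum>y\<in>stopped_paths T. (if stop t y = x then ?w T \<alpha> y else 0) * G y m) +
    (\<Sum>r\<in>{t..<T}. \<Sum>y\<in>stopped_paths r. if stop t y = x then ?w r \<alpha> y * F r y m (\<alpha> (r, y)) else 0)"
  have space: "space \<nu> = space (path_controls t)"
    by (rule sets_eq_imp_space_eq[OF assms(2)])
  have w: "integrable \<nu> (\<lambda>\<alpha>. ?w r \<alpha> y)" if "r \<le> T" "y \<in> stopped_paths r" for r y
    using that assms(5) control_weight_bounds[of _ t r y "\<lambda>_. m"]
    by (intro integrable_control[OF assms(1,2), of _ 1] control_weight_measurable)
       (auto simp: stopped_paths_iff)
  have wF: "integrable \<nu> (\<lambda>\<alpha>. ?w r \<alpha> y * F r y m (\<alpha> (r, y)))"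
    if r: "t \<le> r" "r < T" and y: "y \<in> stopped_paths r" for r y
  proof (rule integrable_control[OF assms(1,2), of _ C_0])
    have y': "y \<in> paths"
      using y by (simp add: stopped_paths_iff)
    show "(\<lambda>\<alpha>. ?w r \<alpha> y * F r y m (\<alpha> (r, y))) \<in> borel_measurable (path_controls t)"
      using r y' assms(5)
      by (intro borel_measurable_times control_weight_measurable
          measurable_compose[OF eval_measurable F_measurable]) auto
    fix \<alpha> assume \<alpha>: "\<alpha> \<in> space (path_controls t)"
    have "\<bar>?w r \<alpha> y\<bar> * \<bar>F r y m (\<alpha> (r, y))\<bar> \<le> 1 * C_0"
      using control_weight_bounds[OF \<alpha>, of r y "\<lambda>_. m"] path_control_in_A[OF \<alpha>, of r y]
        F_bounded[of r y m "\<alpha> (r, y)"] r y' assms(5)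
      by (intro mult_mono) auto
    then show "\<bar>?w r \<alpha> y * F r y m (\<alpha> (r, y))\<bar> \<le> C_0"
      by (simp add: abs_mult)
  qed
  have J: "J m t x (dirac_control \<alpha>) = ?g \<alpha>" if "\<alpha> \<in> space \<nu>" for \<alpha>
    using J_dirac[OF _ assms(5,6,4)] that space by simp
  have int1: "integrable \<nu> (\<lambda>\<alpha>. (if stop t y = x then ?w T \<alpha> y else 0) * G y m)"
    if "y \<in> stopped_paths T" for y
    using w[of T y] that by (cases "stop t y = x") auto
  have int2: "integrable \<nu> (\<lambda>\<alpha>. if stop t y = x then ?w r \<alpha> y * F r y m (\<alpha> (r, y)) else 0)"
    if "r \<in> {t..<T}" "y \<in> stopped_paths r" for r y
    using wF[of r y] that by (cases "stop t y = x") auto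
  have intg: "integrable \<nu> ?g"
    using int1 int2 by (intro Bochner_Integration.integrable_add Bochner_Integration.integrable_sum) auto
  then show "integrable \<nu> (\<lambda>\<alpha>. J m t x (dirac_control \<alpha>))"
    using J by (subst Bochner_Integration.integrable_cong[OF refl, of _ _ ?g]) auto
  have mass: "(\<integral>\<alpha>. ?w r \<alpha> y \<partial>\<nu>) = ?c * path_weight (\<lambda>_. m) t r \<gamma> y"
    if "t \<le> r" "r \<le> T" "y \<in> stopped_paths r" "stop t y = x" for r y
    using that assms(5) by (intro integral_control_weight[OF assms(1-3) order_refl _ assms(7)]) auto
  have 1: "(\<integral>\<alpha>. (if stop t y = x then ?w T \<alpha> y else 0) * G y m \<partial>\<nu>) =
      ?c * (pmf (law m t x \<gamma> (T - t)) y * G y m)" if y: "y \<in> stopped_paths T" for y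
    using mass[of T y] pmf_law[OF assms(3,5,6), of "T - t" y] y assms(4) by simp
  have 2: "(\<integral>\<alpha>. (if stop t y = x then ?w r \<alpha> y * F r y m (\<alpha> (r, y)) else 0) \<partial>\<nu>) =
      ?c * (pmf (law m t x \<gamma> (r - t)) y * (\<integral>a. F r y m a \<partial>\<gamma> r y))"
    if r: "r \<in> {t..<T}" and y: "y \<in> stopped_paths r" for r y
  proof (cases "stop t y = x")
    case True
    have "(\<integral>\<alpha>. ?w r \<alpha> y * F r y m (\<alpha> (r, y)) \<partial>\<nu>) =
        (\<integral>\<alpha>. ?w r \<alpha> y \<partial>\<nu>) * (\<integral>a. F r y m a \<partial>\<gamma> r y)"
      using r y True assms(5)
      by (intro disintegratesD[OF assms(7), of _ _ _ C_0] F_measurable F_bounded)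
         (auto simp: stopped_paths_iff)
    then show ?thesis
      using mass[of r y] pmf_law[OF assms(3,5,6), of "r - t" y] r y True by simp
  next
    case False
    then show ?thesis
      using pmf_law[OF assms(3,5,6), of "r - t" y] r y by simp
  qed
  have "(\<integral>\<alpha>. J m t x (dirac_control \<alpha>) \<partial>\<nu>) = (\<integral>\<alpha>. ?g \<alpha> \<partial>\<nu>)"
    by (rule Bochner_Integration.integral_cong[OF refl J])
  also have "\<dots> = (\<Sum>y\<in>stopped_paths T. \<integral>\<alpha>. (if stop t y = x then ?w T \<alpha> y else 0) * G y m \<partial>\<nu>) +
    (\<Sum>r\<in>{t..<T}. \<Sum>y\<in>stopped_paths r. \<integral>\<alpha>. (if stop t y = x then ?w r \<alpha> y * F r y m (\<alpha> (r, y)) else 0) \<partial>\<nu>)"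
    using int1 int2
    by (subst Bochner_Integration.integral_add)
       (auto intro!: Bochner_Integration.integrable_sum arg_cong2[where f = "(+)"]
          simp: Bochner_Integration.integral_sum)
  also have "\<dots> = ?c * J m t x \<gamma>"
    unfolding J_eq[OF assms(3,5,6,4)] distrib_left sum_distrib_left
    using 1 2 by (intro arg_cong2[where f = "(+)"] sum.cong refl) auto
  finally show "(\<integral>\<alpha>. J m t x (dirac_control \<alpha>) \<partial>\<nu>) = ?c * J m t x \<gamma>" .
qed

section \<open>Identification of the global flow with a relaxed flow\<close>

lemma embed_pmf_pmf: "embed_pmf (pmf p) = p"
  by (rule type_definition.Rep_inverse[OF td_pmf_embed_pmf])

text \<open>Strong induction: the earlier global flows are relaxed flows, hence measures on paths,
  which unlocks disintegration up to \<open>s\<close>. The masses inside \<open>embed_pmf\<close>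
  are then those of an existing \<open>pmf\<close>, so their summing to one comes for free.\<close>

lemma global_flow_eq:
  assumes "\<Lambda> \<in> Xi t" "control_from t \<gamma>" "set_pmf \<mu> \<subseteq> stopped_paths t"
    and "\<And>x. x \<in> stopped_paths t \<Longrightarrow>
      measure (section_measure t \<Lambda> x) (space (path_controls t)) = pmf \<mu> x"
    and "\<And>s x. t \<le> s \<Longrightarrow> s \<le> T \<Longrightarrow> (\<And>r. t \<le> r \<Longrightarrow> r < s \<Longrightarrow> global_flow t \<Lambda> r \<in> path_probs) \<Longrightarrow>
      x \<in> stopped_paths t \<Longrightarrow> disintegrates (global_flow t \<Lambda>) t s x \<gamma> (section_measure t \<Lambda> x)"
    and "t \<le> s" "s \<le> T"
  shows "global_flow t \<Lambda> s = relaxed_flow t \<mu> \<gamma> (s - t)"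
  using assms(6,7)
proof (induction s rule: less_induct)
  case (less s)
  let ?M = "global_flow t \<Lambda>"
  have M: "?M r \<in> path_probs" if "t \<le> r" "r < s" for r
    using less that set_pmf_flow[OF assms(3), of "r - t"] path_probs_if_stopped[of _ r] by simp
  have "(if y \<in> stopped_paths s then section_integral \<Lambda> (stop t y)
       (\<lambda>\<alpha>. \<Prod>r\<in>{t..<s}. q r y (?M r) (\<alpha> (r, y)) (y (Suc r))) else 0) =
      pmf (relaxed_flow t \<mu> \<gamma> (s - t)) y" for y
  proof (cases "y \<in> stopped_paths s")
    case True
    then have y: "y \<in> paths"
      by (simp add: stopped_paths_iff)
    have "section_integral \<Lambda> (stop t y) (\<lambda>\<alpha>. control_weight ?M t s \<alpha> y) =
        (\<integral>\<alpha>. control_weight ?M t s \<alpha> y \<partial>section_measure t \<Lambda> (stop t y))"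
      using less.prems M y by (intro section_integral_eq[OF assms(1)] control_weight_measurable) auto
    also have "\<dots> = pmf \<mu> (stop t y) * path_weight ?M t s \<gamma> y"
    proof -
      have dis: "disintegrates ?M t s (stop t y) \<gamma> (section_measure t \<Lambda> (stop t y))"
        by (rule assms(5)[OF less.prems]) (simp_all add: M)
      have "(\<integral>\<alpha>. control_weight ?M t s \<alpha> y \<partial>section_measure t \<Lambda> (stop t y)) =
          measure (section_measure t \<Lambda> (stop t y)) (space (section_measure t \<Lambda> (stop t y))) *
          path_weight ?M t s \<gamma> y"
        by (rule integral_control_weight[OF finite_measure_section[OF assms(1) stop_in_stopped_paths] sets_section_measure
              assms(2) less.prems(2) _ dis]) (use M less.prems True in auto)
      then show ?thesis
        by (simp add: assms(4))
    qed
    also have "path_weight ?M t s \<gamma> y = path_weight (\<lambda>r. relaxed_flow t \<mu> \<gamma> (r - t)) t s \<gamma> y"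
      unfolding path_weight_def using less by (intro prod.cong refl) auto
    finally show ?thesis
      using pmf_flow[OF assms(2,3), of "s - t" y] less.prems True by (simp add: control_weight_def)
  next
    case False
    then show ?thesis
      using set_pmf_flow[OF assms(3), of "s - t"] less.prems by (auto simp: pmf_eq_0_set_pmf)
  qed
  then show ?case
    unfolding global_flow.simps[of t \<Lambda> s] by (simp add: embed_pmf_pmf)
qed

text \<open>The constant \<open>K\<close> is kept free so that it can become the value at
  \<open>x\<close>. The factor \<open>pmf \<mu> x\<close> in the regret is the mass of the
  unnormalised section.\<close>

lemma
  assumes "\<Lambda> \<in> Xi t" "control_from t \<gamma>" "set_pmf \<mu> \<subseteq> stopped_paths t" "t \<le> T"
    and "\<And>x. x \<in> stopped_paths t \<Longrightarrow>
      measure (section_measure t \<Lambda> x) (space (path_controls t)) = pmf \<mu> x"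
    and "\<And>s x. t \<le> s \<Longrightarrow> s \<le> T \<Longrightarrow> (\<And>r. t \<le> r \<Longrightarrow> r < s \<Longrightarrow> global_flow t \<Lambda> r \<in> path_probs) \<Longrightarrow>
      x \<in> stopped_paths t \<Longrightarrow> disintegrates (global_flow t \<Lambda>) t s x \<gamma> (section_measure t \<Lambda> x)"
  shows global_law_eq_relaxed_law: "global_law t \<Lambda> = relaxed_law t \<mu> \<gamma>"
    and section_integral_regret: "x \<in> stopped_paths t \<Longrightarrow>
      section_integral \<Lambda> x (\<lambda>\<alpha>. J (global_law t \<Lambda>) t x (dirac_control \<alpha>) - K) =
      pmf \<mu> x * (J (global_law t \<Lambda>) t x \<gamma> - K)"
proof -
  have flow: "global_flow t \<Lambda> r = relaxed_flow t \<mu> \<gamma> (r - t)" if "t \<le> r" "r \<le> T" for r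
    by (rule global_flow_eq[OF assms(1-3) _ _ that]) (blast intro: assms(5,6))+
  let ?m = "global_law t \<Lambda>"
  show law: "?m = relaxed_law t \<mu> \<gamma>"
    unfolding global_law_def relaxed_law_def using flow[of T] assms(4) by simp
  have m: "?m \<in> path_probs"
    unfolding law relaxed_law_def
    using set_pmf_flow[OF assms(3), of "T - t"] assms(4) path_probs_if_stopped[of _ T] by simp
  have stop: "global_flow t \<Lambda> r = map_pmf (stop r) ?m" if "t \<le> r" "r \<le> T" for r
    unfolding law relaxed_law_def
    using map_stop_flow[OF assms(3), of "r - t" "T - r" \<gamma>] flow[of r] that by simp
  assume x: "x \<in> stopped_paths t"
  let ?\<nu> = "section_measure t \<Lambda> x"
  interpret finite_measure ?\<nu>
    by (rule finite_measure_section[OF assms(1) x])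
  have "disintegrates (global_flow t \<Lambda>) t T x \<gamma> ?\<nu>"
    using assms(4) x stop by (intro assms(6)) auto
  moreover have "(\<integral>\<alpha>. control_weight (global_flow t \<Lambda>) t r \<alpha> y * h \<alpha> \<partial>?\<nu>) =
      (\<integral>\<alpha>. control_weight (\<lambda>_. ?m) t r \<alpha> y * h \<alpha> \<partial>?\<nu>)"
    if "r < T" "y \<in> stopped_paths r" for r y and h :: "_ \<Rightarrow> real"
    using that stop m control_weight_cong_flow[of _ t r y ?m "global_flow t \<Lambda>"]
    by (intro Bochner_Integration.integral_cong) (auto simp: stopped_paths_iff)
  note this this[where h = "\<lambda>_. 1"]
  ultimately have dis: "disintegrates (\<lambda>_. ?m) t T x \<gamma> ?\<nu>"
    unfolding disintegrates_def by simp
  note * = finite_measure_axioms sets_section_measure assms(2,4) m x dis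
  have int: "integrable ?\<nu> (\<lambda>\<alpha>. J ?m t x (dirac_control \<alpha>))"
    by (rule J_dirac_integrable[OF *])
  have meas: "(\<lambda>\<alpha>. J ?m t x (dirac_control \<alpha>)) \<in> borel_measurable (path_controls t)"
    using borel_measurable_integrable[OF int]
    unfolding measurable_cong_sets[OF sets_section_measure refl] .
  then have "section_integral \<Lambda> x (\<lambda>\<alpha>. J ?m t x (dirac_control \<alpha>) - K) =
      (\<integral>\<alpha>. J ?m t x (dirac_control \<alpha>) - K \<partial>?\<nu>)"
    by (intro section_integral_eq[OF assms(1) x]) auto
  also have "\<dots> = measure ?\<nu> (space ?\<nu>) * J ?m t x \<gamma> - measure ?\<nu> (space ?\<nu>) * K"
    using int by (simp add: integral_J_dirac[OF *])
  finally show "section_integral \<Lambda> x (\<lambda>\<alpha>. J ?m t x (dirac_control \<alpha>) - K) =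
      pmf \<mu> x * (J ?m t x \<gamma> - K)"
    using assms(5)[OF x] by (simp add: right_diff_distrib)
qed

subsection \<open>Passing between relaxed and global controls\<close>

text \<open>Conditioning amounts to normalising \<open>w\<close> to a probability density and
  pushing the measure forward along \<open>e\<close>.\<close>

lemma conditional_law_exists:
  fixes w :: "'b \<Rightarrow> real"
  assumes "finite_measure \<nu>" "w \<in> borel_measurable \<nu>" "e \<in> \<nu> \<rightarrow>\<^sub>M action_space"
    and w: "\<And>\<alpha>. \<alpha> \<in> space \<nu> \<Longrightarrow> 0 \<le> w \<alpha>" "\<And>\<alpha>. \<alpha> \<in> space \<nu> \<Longrightarrow> w \<alpha> \<le> 1"
  shows "\<exists>\<kappa>\<in>space (prob_algebra action_space). \<forall>f\<in>borel_measurable action_space.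
    (\<integral>\<alpha>. w \<alpha> * f (e \<alpha>) \<partial>\<nu>) = (\<integral>\<alpha>. w \<alpha> \<partial>\<nu>) * (\<integral>a. f a \<partial>\<kappa> :: real)"
proof -
  interpret finite_measure \<nu> by (rule assms(1))
  note [measurable] = assms(2,3)
  define Z where "Z = (\<integral>\<alpha>. w \<alpha> \<partial>\<nu>)"
  have int: "integrable \<nu> w"
    using w by (intro integrable_const_bound[where B = 1]) auto
  have Z: "0 \<le> Z"
    unfolding Z_def using w(1) by (intro integral_nonneg_AE AE_I2) auto
  show ?thesis
  proof (cases "Z = 0")
    case True
    then have zero: "AE \<alpha> in \<nu>. w \<alpha> = 0"
      using integral_nonneg_eq_0_iff_AE[OF int] w(1) by (auto simp: Z_def)
    \<comment> \<open>With zero total weight, for instance on a null section, both sides vanish and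
      any law on \<open>A\<close> serves.\<close>
    obtain a where "a \<in> A"
      using A_nonempty by auto
    then have "return action_space a \<in> space (prob_algebra action_space)"
      by (auto simp: space_prob_algebra intro!: prob_space_return)
    moreover have "(\<integral>\<alpha>. w \<alpha> * f (e \<alpha>) \<partial>\<nu>) = 0" for f :: "'a \<Rightarrow> real"
      using zero by (intro integral_eq_zero_AE) auto
    ultimately show ?thesis
      using True unfolding Z_def by (intro bexI[of _ "return action_space a"]) auto
  next
    case False
    with Z have Zpos: "Z > 0"
      by simp
    let ?D = "density \<nu> (\<lambda>\<alpha>. ennreal (w \<alpha> / Z))"
    have "(\<integral>\<^sup>+\<alpha>. ennreal (w \<alpha> / Z) \<partial>\<nu>) = ennreal (\<integral>\<alpha>. w \<alpha> / Z \<partial>\<nu>)"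
      using int w(1) Zpos by (intro nn_integral_eq_integral) auto
    also have "(\<integral>\<alpha>. w \<alpha> / Z \<partial>\<nu>) = 1"
      using Zpos by (simp flip: Z_def)
    finally have "emeasure ?D (space ?D) = 1"
      by (simp add: emeasure_density cong: nn_integral_cong)
    then interpret D: prob_space ?D
      by (rule prob_spaceI)
    let ?\<kappa> = "distr ?D action_space e"
    have "?\<kappa> \<in> space (prob_algebra action_space)"
      by (auto simp: space_prob_algebra intro!: D.prob_space_distr)
    moreover have "(\<integral>\<alpha>. w \<alpha> * f (e \<alpha>) \<partial>\<nu>) = Z * (\<integral>a. f a \<partial>?\<kappa>)"
      if [measurable]: "f \<in> borel_measurable action_space" for f :: "'a \<Rightarrow> real"
    proof -
      have "(\<integral>a. f a \<partial>?\<kappa>) = (\<integral>\<alpha>. f (e \<alpha>) \<partial>?D)"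
        by (rule integral_distr) auto
      also have "\<dots> = (\<integral>\<alpha>. (w \<alpha> / Z) *\<^sub>R f (e \<alpha>) \<partial>\<nu>)"
        using w(1) Zpos by (intro integral_density) auto
      also have "\<dots> = (\<integral>\<alpha>. w \<alpha> * f (e \<alpha>) \<partial>\<nu>) / Z"
        by simp
      finally show ?thesis
        using Zpos by simp
    qed
    ultimately show ?thesis
      by (intro bexI[of _ ?\<kappa>]) (auto simp flip: Z_def)
  qed
qed

text \<open>One \<gamma> has to work for all horizons \<open>s\<close>, and for \<open>M\<close> the
  global flow, not yet known to consist of measures on paths. Hence \<gamma> is chosen before
  \<open>s\<close>, and membership in \<open>path_probs\<close> appears as a premise inside the
  conclusion.\<close>

lemma relaxed_control_of_global:
  assumes \<Lambda>: "\<Lambda> \<in> Xi t"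
  shows "\<exists>\<gamma>\<in>relaxed_controls. \<forall>s\<le>T. (\<forall>r\<in>{t..<s}. M r \<in> path_probs) \<longrightarrow>
    (\<forall>x\<in>stopped_paths t. disintegrates M t s x \<gamma> (section_measure t \<Lambda> x))"
proof -
  let ?\<nu> = "\<lambda>y. section_measure t \<Lambda> (stop t y)"
  \<comment> \<open>The premises sit inside \<open>P\<close>, so that a law can be chosen at every
    pair \<open>(r, y)\<close>, arbitrarily where they fail.\<close>
  define P where "P r y \<kappa> \<longleftrightarrow> (t \<le> r \<and> r < T \<and> y \<in> paths \<and> (\<forall>r'\<in>{t..<r}. M r' \<in> path_probs) \<longrightarrow>
      (\<forall>f\<in>borel_measurable action_space.
        (\<integral>\<alpha>. control_weight M t r \<alpha> y * f (\<alpha> (r, y)) \<partial>?\<nu> y) =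
        (\<integral>\<alpha>. control_weight M t r \<alpha> y \<partial>?\<nu> y) * (\<integral>a. f a \<partial>\<kappa> :: real)))" for r y \<kappa>
  have "\<exists>\<kappa>. \<kappa> \<in> space (prob_algebra action_space) \<and> P r y \<kappa>" for r y
  proof (cases "t \<le> r \<and> r < T \<and> y \<in> paths \<and> (\<forall>r'\<in>{t..<r}. M r' \<in> path_probs)")
    case True
    then have "(\<lambda>\<alpha>. control_weight M t r \<alpha> y) \<in> borel_measurable (?\<nu> y)"
      unfolding measurable_cong_sets[OF sets_section_measure refl]
      by (intro control_weight_measurable) auto
    moreover have "(\<lambda>\<alpha>. \<alpha> (r, y)) \<in> ?\<nu> y \<rightarrow>\<^sub>M action_space"
      unfolding measurable_cong_sets[OF sets_section_measure refl]
      using True by (intro eval_measurable) auto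
    ultimately have "\<exists>\<kappa>\<in>space (prob_algebra action_space). \<forall>f\<in>borel_measurable action_space.
        (\<integral>\<alpha>. control_weight M t r \<alpha> y * f (\<alpha> (r, y)) \<partial>?\<nu> y) =
        (\<integral>\<alpha>. control_weight M t r \<alpha> y \<partial>?\<nu> y) * (\<integral>a. f a \<partial>\<kappa> :: real)"
      using True
      by (intro conditional_law_exists[OF finite_measure_section[OF \<Lambda> stop_in_stopped_paths]]
          control_weight_bounds) auto
    then show ?thesis
      unfolding P_def by blast
  next
    case False
    obtain a where "a \<in> A"
      using A_nonempty by auto
    then have "return action_space a \<in> space (prob_algebra action_space)"
      by (auto simp: space_prob_algebra intro!: prob_space_return)
    with False show ?thesis
      unfolding P_def by blast
  qed
  then obtain \<kappa> where \<kappa>: "\<And>r y. \<kappa> r y \<in> space (prob_algebra action_space)"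
    and P: "\<And>r y. P r y (\<kappa> r y)"
    by metis
  have eq: "(\<integral>\<alpha>. control_weight M t r \<alpha> y * f (\<alpha> (r, y)) \<partial>?\<nu> y) =
      (\<integral>\<alpha>. control_weight M t r \<alpha> y \<partial>?\<nu> y) * (\<integral>a. f a \<partial>\<kappa> r y :: real)"
    if "t \<le> r" "r < T" "y \<in> paths" "\<And>r'. t \<le> r' \<Longrightarrow> r' < r \<Longrightarrow> M r' \<in> path_probs"
      "f \<in> borel_measurable action_space" for r y f
    using P[of r y] that unfolding P_def by simp
  show ?thesis
  \<comment> \<open>Reading \<kappa> at the stopped path enforces adaptedness and changes nothing on
    stopped paths.\<close>
  proof (rule bexI[of _ "\<lambda>r y. \<kappa> r (stop r y)"], intro allI impI ballI)
    show "(\<lambda>r y. \<kappa> r (stop r y)) \<in> relaxed_controls"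
      using \<kappa> by (auto simp: relaxed_controls_def stop_stop)
    show "disintegrates M t s x (\<lambda>r y. \<kappa> r (stop r y)) (section_measure t \<Lambda> x)"
      if "s \<le> T" "\<forall>r\<in>{t..<s}. M r \<in> path_probs" "x \<in> stopped_paths t" for s x
      unfolding disintegrates_def
    proof (intro ballI impI)
      fix r y and f :: "'a \<Rightarrow> real"
      assume r: "r \<in> {t..<s}" and y: "y \<in> stopped_paths r" "stop t y = x"
        and f: "f \<in> borel_measurable action_space"
      have "y \<in> paths" "stop r y = y"
        using y(1) by (simp_all add: stopped_paths_iff)
      then show "(\<integral>\<alpha>. control_weight M t r \<alpha> y * f (\<alpha> (r, y)) \<partial>section_measure t \<Lambda> x) =
          (\<integral>\<alpha>. control_weight M t r \<alpha> y \<partial>section_measure t \<Lambda> x) * (\<integral>a. f a \<partial>\<kappa> r (stop r y))"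
        using eq[of r y f] r that f y(2) by simp
    qed
  qed
qed

text \<open>Under the product measure the actions at different \<open>(r, y)\<close> are independent with laws
  \<open>\<gamma> r y\<close>; reading the coordinate \<open>(r, stop r y)\<close> instead of \<open>(r, y)\<close> makes the control adapted.\<close>

lemma independent_path_control:
  assumes \<gamma>: "control_from t \<gamma>"
  shows "\<exists>K. prob_space K \<and> sets K = sets (path_controls t) \<and>
    (\<forall>M r y. \<forall>f\<in>borel_measurable action_space. t \<le> r \<longrightarrow> r < T \<longrightarrow> y \<in> paths \<longrightarrow>
      (\<forall>r'\<in>{t..<r}. M r' \<in> path_probs) \<longrightarrow> (\<exists>B. \<forall>a\<in>A. \<bar>f a\<bar> \<le> B) \<longrightarrow>
      (\<integral>\<alpha>. control_weight M t r \<alpha> y * f (\<alpha> (r, y)) \<partial>K) =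
      path_weight M t r \<gamma> y * (\<integral>a. f a \<partial>\<gamma> r y :: real))"
proof -
  obtain a0 where a0: "a0 \<in> A"
    using A_nonempty by auto
  let ?I = "{t..<T} \<times> paths"
  \<comment> \<open>The default law makes \<open>N\<close> a family of probability measures over all
    indices, as \<open>product_sigma_finite\<close> demands.\<close>
  define N where "N i = (if i \<in> ?I then \<gamma> (fst i) (snd i) else return action_space a0)" for i
  have N: "N i \<in> space (prob_algebra action_space)" for i
    using control_from_prob[OF \<gamma>, of "fst i" "snd i"] a0
    by (auto simp: N_def space_prob_algebra intro!: prob_space_return)
  then have Nprob: "prob_space (N i)" and Nsets: "sets (N i) = sets action_space" for i
    by (auto simp: space_prob_algebra)
  have "sigma_finite_measure (N i)" for i
  proof -
    interpret prob_space "N i" by (rule Nprob)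
    show ?thesis ..
  qed
  then interpret product_sigma_finite N
    by (simp add: product_sigma_finite_def)
  let ?P = "Pi\<^sub>M ?I N"
  have setsP: "sets ?P = sets (Pi\<^sub>M ?I (\<lambda>_. action_space))"
    by (rule sets_PiM_cong) (auto simp: Nsets)
  have spaceP: "space ?P = ?I \<rightarrow>\<^sub>E A"
    using sets_eq_imp_space_eq[OF setsP] by (simp add: space_PiM)
  interpret P: prob_space ?P
    using Nprob by (intro prob_space_PiM) auto
  define \<phi> where "\<phi> \<omega> = (\<lambda>i\<in>?I. \<omega> (fst i, stop (fst i) (snd i)))" for \<omega> :: "nat \<times> (nat \<Rightarrow> 's) \<Rightarrow> 'a"
  have \<phi>: "\<phi> \<in> ?P \<rightarrow>\<^sub>M path_controls t"
    unfolding path_controls_def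
  proof (rule measurable_restrict_space2)
    show "\<phi> \<in> space ?P \<rightarrow> {\<alpha>. \<forall>s\<in>{t..<T}. \<forall>x\<in>paths. \<alpha> (s, x) = \<alpha> (s, stop s x)}"
      by (auto simp: \<phi>_def stop_stop)
    show "\<phi> \<in> ?P \<rightarrow>\<^sub>M Pi\<^sub>M ?I (\<lambda>_. action_space)"
      unfolding \<phi>_def measurable_cong_sets[OF setsP refl]
      by (intro measurable_restrict measurable_component_singleton) auto
  qed
  let ?K = "distr ?P (path_controls t) \<phi>"
  show ?thesis
  proof (rule exI[of _ ?K], intro conjI allI impI ballI)
    show "prob_space ?K"
      by (rule P.prob_space_distr[OF \<phi>])
    show "sets ?K = sets (path_controls t)"
      by simp
    fix M r y and f :: "'a \<Rightarrow> real"
    assume r: "t \<le> r" "r < T" and y: "y \<in> paths"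
      and M: "\<forall>r'\<in>{t..<r}. M r' \<in> path_probs"
      and f: "f \<in> borel_measurable action_space" and "\<exists>B. \<forall>a\<in>A. \<bar>f a\<bar> \<le> B"
    then obtain B where B: "\<And>a. a \<in> A \<Longrightarrow> \<bar>f a\<bar> \<le> B"
      by auto
    \<comment> \<open>The integrand reads exactly the coordinates \<open>(r', stop r' y)\<close>
      with \<open>t \<le> r' \<le> r\<close>, pairwise distinct since their times differ. Padding
      the others with the constant 1 gives a product over the whole index set, to which Fubini
      applies.\<close>
    define g where "g r' = (if r' < r then (\<lambda>a. q r' y (M r') a (y (Suc r'))) else f)" for r'
    define h where "h i = (if fst i \<le> r \<and> snd i = stop (fst i) y then g (fst i) else (\<lambda>_. 1))"
      for i :: "nat \<times> (nat \<Rightarrow> 's)"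
    have g_int: "integrable \<nu> (g r')"
      if "t \<le> r'" "r' \<le> r" "\<nu> \<in> space (prob_algebra action_space)" for r' \<nu>
    proof (cases "r' < r")
      case True
      then show ?thesis
        using that r y M unfolding g_def by (simp add: integrable_q)
    next
      case False
      then show ?thesis
        using integrable_action[OF that(3) f B] by (simp add: g_def)
    qed
    have h_int: "integrable (N i) (h i)" if "i \<in> ?I" for i
    proof (cases "fst i \<le> r \<and> snd i = stop (fst i) y")
      case True
      then show ?thesis
        using g_int[of "fst i" "N i"] N that by (auto simp: h_def)
    next
      case False
      interpret prob_space "N i" by (rule Nprob)
      from False show ?thesis
        by (auto simp: h_def)
    qed
    have prod_collapse: "(\<Prod>i\<in>?I. if fst i \<le> r \<and> snd i = stop (fst i) y then k (fst i) else 1) =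
        (\<Prod>r'\<in>{t..r}. k r')" for k :: "nat \<Rightarrow> real"
    proof -
      have "(\<Prod>i\<in>?I. if fst i \<le> r \<and> snd i = stop (fst i) y then k (fst i) else 1) =
          (\<Prod>r'\<in>{t..<T}. \<Prod>x\<in>paths. if r' \<le> r \<and> x = stop r' y then k r' else 1)"
        by (simp add: prod.cartesian_product' cong: if_cong)
      also have "\<dots> = (\<Prod>r'\<in>{t..<T}. if r' \<le> r then k r' else 1)"
        by (intro prod.cong refl) (simp add: prod.delta)
      also have "\<dots> = (\<Prod>r'\<in>{t..r}. if r' \<le> r then k r' else 1)"
        using r by (intro prod.mono_neutral_right) auto
      also have "\<dots> = (\<Prod>r'\<in>{t..r}. k r')"
        by (intro prod.cong) auto
      finally show ?thesis .
    qed
    have split: "(\<Prod>r'\<in>{t..r}. k r') = (\<Prod>r'\<in>{t..<r}. k r') * k r" for k :: "nat \<Rightarrow> real"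
      using r(1) by (metis atLeastLessThanSuc_atLeastAtMost prod.atLeastLessThan_Suc)
    have "(\<integral>\<alpha>. control_weight M t r \<alpha> y * f (\<alpha> (r, y)) \<partial>?K) =
        (\<integral>\<omega>. control_weight M t r (\<phi> \<omega>) y * f (\<phi> \<omega> (r, y)) \<partial>?P)"
      using r y M f
      by (intro integral_distr[OF \<phi>] borel_measurable_times control_weight_measurable
          measurable_compose[OF eval_measurable]) auto
    also have "\<dots> = (\<integral>\<omega>. (\<Prod>i\<in>?I. h i (\<omega> i)) \<partial>?P)"
    proof (rule Bochner_Integration.integral_cong[OF refl])
      fix \<omega>
      have "control_weight M t r (\<phi> \<omega>) y * f (\<phi> \<omega> (r, y)) = (\<Prod>r'\<in>{t..r}. g r' (\<omega> (r', stop r' y)))"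
        unfolding split control_weight_def
        using r y by (intro arg_cong2[where f = "(*)"] prod.cong) (auto simp: g_def \<phi>_def)
      also have "\<dots> = (\<Prod>i\<in>?I. h i (\<omega> i))"
        unfolding prod_collapse[symmetric]
        by (intro prod.cong refl) (auto simp: h_def)
      finally show "control_weight M t r (\<phi> \<omega>) y * f (\<phi> \<omega> (r, y)) = (\<Prod>i\<in>?I. h i (\<omega> i))" .
    qed
    also have "\<dots> = (\<Prod>i\<in>?I. integral\<^sup>L (N i) (h i))"
      using h_int by (intro product_integral_prod) auto
    \<comment> \<open>On the path, adaptedness replaces the law at the stopped path by the one at
      \<open>y\<close>; a padded coordinate contributes 1 because its law is a probability
      measure.\<close>
    also have "\<dots> = (\<Prod>i\<in>?I. if fst i \<le> r \<and> snd i = stop (fst i) y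
        then integral\<^sup>L (\<gamma> (fst i) y) (g (fst i)) else 1)"
    proof (rule prod.cong[OF refl])
      fix i assume i: "i \<in> ?I"
      interpret prob_space "N i" by (rule Nprob)
      show "integral\<^sup>L (N i) (h i) = (if fst i \<le> r \<and> snd i = stop (fst i) y
        then integral\<^sup>L (\<gamma> (fst i) y) (g (fst i)) else 1)"
        using i control_from_stop[OF \<gamma>, of "fst i" y] y prob_space
        by (auto simp: h_def N_def)
    qed
    also have "\<dots> = (\<Prod>r'\<in>{t..r}. integral\<^sup>L (\<gamma> r' y) (g r'))"
      by (rule prod_collapse)
    also have "\<dots> = path_weight M t r \<gamma> y * (\<integral>a. f a \<partial>\<gamma> r y)"
      unfolding split path_weight_def
      by (intro arg_cong2[where f = "(*)"] prod.cong) (auto simp: g_def)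
    finally show "(\<integral>\<alpha>. control_weight M t r \<alpha> y * f (\<alpha> (r, y)) \<partial>?K) =
      path_weight M t r \<gamma> y * (\<integral>a. f a \<partial>\<gamma> r y)" .
  qed
qed

text \<open>For independent initial path and control, the section at \<open>x\<close> is
  \<open>K\<close> scaled by the mass of \<open>x\<close>.\<close>

lemma product_in_Xi:
  assumes "prob_space K" "sets K = sets (path_controls t)" "set_pmf \<mu> \<subseteq> stopped_paths t"
  shows "\<exists>\<Lambda>\<in>Xi t. \<forall>x\<in>stopped_paths t. \<forall>f\<in>borel_measurable (path_controls t).
      (\<exists>B. \<forall>\<alpha>\<in>space (path_controls t). \<bar>f \<alpha>\<bar> \<le> B) \<longrightarrow>
      (\<integral>\<alpha>. f \<alpha> \<partial>section_measure t \<Lambda> x) = pmf \<mu> x * (\<integral>\<alpha>. f \<alpha> \<partial>K :: real)"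
proof -
  interpret K: prob_space K by (rule assms(1))
  interpret pair_prob_space "measure_pmf \<mu>" K ..
  let ?Q = "measure_pmf \<mu> \<Otimes>\<^sub>M K"
  let ?R = "count_space (stopped_paths t) \<Otimes>\<^sub>M path_controls t"
  \<comment> \<open>\<open>measure_pmf \<mu>\<close> lives on the whole type, whereas
    \<open>Xi\<close> asks for the counting space on stopped paths. Stopping moves between them and
    is the identity on the support of \<mu>.\<close>
  define \<psi> where "\<psi> z = (stop t (fst z), snd z)" for z :: "(nat \<Rightarrow> 's) \<times> (nat \<times> (nat \<Rightarrow> 's) \<Rightarrow> 'a)"
  have [measurable_cong]: "sets K = sets (path_controls t)" by (rule assms(2))
  have spaceK: "space K = space (path_controls t)"
    by (rule sets_eq_imp_space_eq[OF assms(2)])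
  have st: "(\<lambda>z. stop t (fst z)) \<in> ?Q \<rightarrow>\<^sub>M count_space (stopped_paths t)"
    by (rule measurable_compose[OF measurable_fst]) auto
  have \<psi>: "\<psi> \<in> ?Q \<rightarrow>\<^sub>M ?R"
    unfolding \<psi>_def using st by measurable
  let ?\<Lambda> = "distr ?Q ?R \<psi>"
  have Xi: "?\<Lambda> \<in> Xi t"
    using P.prob_space_distr[OF \<psi>] by (auto simp: Xi_def space_prob_algebra)
  show ?thesis
  proof (rule bexI[OF _ Xi], intro ballI impI)
    fix x and f :: "(nat \<times> (nat \<Rightarrow> 's) \<Rightarrow> 'a) \<Rightarrow> real"
    assume x: "x \<in> stopped_paths t" and f: "f \<in> borel_measurable (path_controls t)"
      and "\<exists>B. \<forall>\<alpha>\<in>space (path_controls t). \<bar>f \<alpha>\<bar> \<le> B"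
    then obtain B where B: "\<And>\<alpha>. \<alpha> \<in> space (path_controls t) \<Longrightarrow> \<bar>f \<alpha>\<bar> \<le> B"
      by auto
    let ?S = "{z \<in> space ?\<Lambda>. fst z = x}"
    let ?F = "\<lambda>z. indicator {x} (stop t (fst z)) * f (snd z)"
    have ind: "(indicator {x} :: _ \<Rightarrow> real) \<in> borel_measurable (count_space (stopped_paths t))"
      by simp
    have Fmeas: "?F \<in> borel_measurable ?Q"
      by (intro borel_measurable_times measurable_compose[OF st ind]
          measurable_compose[OF measurable_snd]) (use f in measurable)
    have Fint: "integrable ?Q ?F"
      using B Fmeas
      by (intro P.integrable_const_bound[where B = "\<bar>B\<bar>"])
         (auto simp: space_pair_measure spaceK indicator_def intro!: order_trans[OF B])
    have "(\<integral>\<alpha>. f \<alpha> \<partial>section_measure t ?\<Lambda> x) = section_integral ?\<Lambda> x f"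
      by (rule section_integral_eq[OF Xi x f, symmetric])
    also have "\<dots> = (\<integral>z. indicator ?S z *\<^sub>R f (snd z) \<partial>?\<Lambda>)"
      by (simp add: section_integral_def set_lebesgue_integral_def)
    also have "\<dots> = (\<integral>z. indicator ?S (\<psi> z) *\<^sub>R f (snd (\<psi> z)) \<partial>?Q)"
    proof (rule integral_distr[OF \<psi>])
      have "?S \<in> sets ?R"
        using section_in_sets[OF Xi x] by simp
      then show "(\<lambda>z. indicator ?S z *\<^sub>R f (snd z)) \<in> borel_measurable ?R"
        using f by (intro borel_measurable_scaleR borel_measurable_indicator
            measurable_compose[OF measurable_snd]) auto
    qed
    also have "\<dots> = (\<integral>z. ?F z \<partial>?Q)"
      by (intro Bochner_Integration.integral_cong refl)
         (auto simp: \<psi>_def indicator_def space_pair_measure spaceK)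
    also have "\<dots> = (\<integral>y. (\<integral>\<alpha>. ?F (y, \<alpha>) \<partial>K) \<partial>measure_pmf \<mu>)"
      by (rule integral_fst'[OF Fint, symmetric])
    also have "\<dots> = (\<integral>y. indicator {x} y * (\<integral>\<alpha>. f \<alpha> \<partial>K) \<partial>measure_pmf \<mu>)"
      using assms(3)
      by (intro integral_cong_AE AE_pmfI) (auto simp: stopped_paths_iff)
    also have "\<dots> = pmf \<mu> x * (\<integral>\<alpha>. f \<alpha> \<partial>K)"
      by (simp add: measure_pmf_single)
    finally show "(\<integral>\<alpha>. f \<alpha> \<partial>section_measure t ?\<Lambda> x) = pmf \<mu> x * (\<integral>\<alpha>. f \<alpha> \<partial>K)" .
  qed
qed

text \<open>Packages what is transferred between the two formulations; with \<open>K\<close>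
  quantified, the value can be inserted at each \<open>x\<close> separately.\<close>

definition same_regret where
  "same_regret t \<mu> \<Lambda> \<gamma> \<longleftrightarrow> (\<forall>x\<in>stopped_paths t. \<forall>K.
     section_integral \<Lambda> x (\<lambda>\<alpha>. J (global_law t \<Lambda>) t x (dirac_control \<alpha>) - K) =
     pmf \<mu> x * (J (global_law t \<Lambda>) t x \<gamma> - K))"

lemma same_regretD:
  "same_regret t \<mu> \<Lambda> \<gamma> \<Longrightarrow> x \<in> stopped_paths t \<Longrightarrow>
    section_integral \<Lambda> x (\<lambda>\<alpha>. J (global_law t \<Lambda>) t x (dirac_control \<alpha>) - K) =
    pmf \<mu> x * (J (global_law t \<Lambda>) t x \<gamma> - K)"
  by (simp add: same_regret_def)

text \<open>The weight up to \<open>r\<close> involves actions at earlier times only. Under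
  independent draws, reweighting therefore leaves the law of the action at \<open>(r, y)\<close>
  unchanged, which is disintegration by \<gamma>.\<close>

lemma global_of_relaxed:
  assumes \<gamma>: "\<gamma> \<in> relaxed_controls" and \<mu>: "set_pmf \<mu> \<subseteq> stopped_paths t" and "t \<le> T"
  shows "\<exists>\<Lambda>\<in>Xi_of t \<mu>. global_law t \<Lambda> = relaxed_law t \<mu> \<gamma> \<and> same_regret t \<mu> \<Lambda> \<gamma>"
proof -
  have c: "control_from t \<gamma>"
    by (rule control_from_relaxed[OF \<gamma>])
  obtain K where K: "prob_space K" "sets K = sets (path_controls t)"
    and KI: "\<forall>M r y. \<forall>f\<in>borel_measurable action_space. t \<le> r \<longrightarrow> r < T \<longrightarrow> y \<in> paths \<longrightarrow>
      (\<forall>r'\<in>{t..<r}. M r' \<in> path_probs) \<longrightarrow> (\<exists>B. \<forall>a\<in>A. \<bar>f a\<bar> \<le> B) \<longrightarrow>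
      (\<integral>\<alpha>. control_weight M t r \<alpha> y * f (\<alpha> (r, y)) \<partial>K) =
      path_weight M t r \<gamma> y * (\<integral>a. f a \<partial>\<gamma> r y :: real)"
    using independent_path_control[OF c] by blast
  obtain \<Lambda> where \<Lambda>: "\<Lambda> \<in> Xi t"
    and \<Lambda>I: "\<forall>x\<in>stopped_paths t. \<forall>f\<in>borel_measurable (path_controls t).
      (\<exists>B. \<forall>\<alpha>\<in>space (path_controls t). \<bar>f \<alpha>\<bar> \<le> B) \<longrightarrow>
      (\<integral>\<alpha>. f \<alpha> \<partial>section_measure t \<Lambda> x) = pmf \<mu> x * (\<integral>\<alpha>. f \<alpha> \<partial>K :: real)"
    using product_in_Xi[OF K \<mu>] by blast
  have mass: "measure (section_measure t \<Lambda> x) (space (path_controls t)) = pmf \<mu> x"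
    if "x \<in> stopped_paths t" for x
  proof -
    interpret K: prob_space K by (rule K(1))
    show ?thesis
      using \<Lambda>I[rule_format, OF that, of "\<lambda>_. 1"] K.prob_space by auto
  qed
  have dis: "disintegrates M t s x \<gamma> (section_measure t \<Lambda> x)"
    if s: "s \<le> T" and M: "\<And>r. t \<le> r \<Longrightarrow> r < s \<Longrightarrow> M r \<in> path_probs" and x: "x \<in> stopped_paths t"
    for M s x
    unfolding disintegrates_def
  proof (intro ballI impI)
    fix r y and f :: "'a \<Rightarrow> real"
    assume r: "r \<in> {t..<s}" and y: "y \<in> stopped_paths r" "stop t y = x"
      and f: "f \<in> borel_measurable action_space" "\<exists>B. \<forall>a\<in>A. \<bar>f a\<bar> \<le> B"
    have y': "y \<in> paths"
      using y by (simp add: stopped_paths_iff)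
    have eq: "(\<integral>\<alpha>. control_weight M t r \<alpha> y * g (\<alpha> (r, y)) \<partial>section_measure t \<Lambda> x) =
        pmf \<mu> x * (path_weight M t r \<gamma> y * (\<integral>a. g a \<partial>\<gamma> r y))"
      if g: "g \<in> borel_measurable action_space" "\<exists>B. \<forall>a\<in>A. \<bar>g a\<bar> \<le> B" for g :: "'a \<Rightarrow> real"
    proof -
      obtain B where B: "\<And>a. a \<in> A \<Longrightarrow> \<bar>g a\<bar> \<le> B"
        using g(2) by auto
      have meas: "(\<lambda>\<alpha>. control_weight M t r \<alpha> y * g (\<alpha> (r, y))) \<in> borel_measurable (path_controls t)"
        using r s y' M g(1)
        by (intro borel_measurable_times control_weight_measurable
            measurable_compose[OF eval_measurable]) auto
      have "\<bar>control_weight M t r \<alpha> y * g (\<alpha> (r, y))\<bar> \<le> 1 * B"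
        if \<alpha>: "\<alpha> \<in> space (path_controls t)" for \<alpha>
        unfolding abs_mult
        using control_weight_bounds[OF \<alpha>, of r y M] r s y' M B[OF path_control_in_A[OF \<alpha>]]
        by (intro mult_mono) auto
      then show ?thesis
        using \<Lambda>I[rule_format, OF x meas] KI[rule_format, of g r y M] r s y' M g by auto
    qed
    \<comment> \<open>The instance \<open>g = 1\<close> of \<open>eq\<close> evaluates the total
      weight on the right-hand side.\<close>
    have one: "\<exists>B. \<forall>a\<in>A. \<bar>1 :: real\<bar> \<le> B"
      by auto
    interpret prob_space "\<gamma> r y"
      using control_from_prob_space[OF c, of r y] r s y' by simp
    show "(\<integral>\<alpha>. control_weight M t r \<alpha> y * f (\<alpha> (r, y)) \<partial>section_measure t \<Lambda> x) =
        (\<integral>\<alpha>. control_weight M t r \<alpha> y \<partial>section_measure t \<Lambda> x) * (\<integral>a. f a \<partial>\<gamma> r y)"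
      using eq[OF f] eq[OF _ one] prob_space by simp
  qed
  have law: "global_law t \<Lambda> = relaxed_law t \<mu> \<gamma>"
    by (rule global_law_eq_relaxed_law[OF \<Lambda> c \<mu> \<open>t \<le> T\<close>]) (blast intro: mass dis)+
  moreover have "map_pmf (stop t) (relaxed_law t \<mu> \<gamma>) = \<mu>"
    using map_stop_flow[OF \<mu>, of 0 "T - t" \<gamma>] \<open>t \<le> T\<close> by (simp add: relaxed_law_def)
  ultimately have "\<Lambda> \<in> Xi_of t \<mu>"
    using \<Lambda> by (simp add: Xi_of_def)
  moreover have "same_regret t \<mu> \<Lambda> \<gamma>"
    unfolding same_regret_def
    by (intro ballI allI section_integral_regret[OF \<Lambda> c \<mu> \<open>t \<le> T\<close>]) (blast intro: mass dis)+
  ultimately show ?thesis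
    using law by blast
qed

text \<open>\<open>Xi_of\<close> prescribes the initial law only through the terminal law stopped at
  \<open>t\<close>, while the constructions need the section masses. The flow is first identified
  with the relaxed one started from those masses.\<close>

lemma relaxed_of_global:
  assumes \<Lambda>: "\<Lambda> \<in> Xi_of t \<mu>" and "t \<le> T"
  shows "\<exists>\<gamma>\<in>relaxed_controls. global_law t \<Lambda> = relaxed_law t \<mu> \<gamma> \<and> same_regret t \<mu> \<Lambda> \<gamma>"
proof -
  have \<Lambda>': "\<Lambda> \<in> Xi t" and marg: "map_pmf (stop t) (global_law t \<Lambda>) = \<mu>"
    using \<Lambda> by (auto simp: Xi_of_def)
  obtain \<gamma> where \<gamma>: "\<gamma> \<in> relaxed_controls"
    and dis: "\<forall>s\<le>T. (\<forall>r\<in>{t..<s}. global_flow t \<Lambda> r \<in> path_probs) \<longrightarrow>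
      (\<forall>x\<in>stopped_paths t. disintegrates (global_flow t \<Lambda>) t s x \<gamma> (section_measure t \<Lambda> x))"
    using relaxed_control_of_global[OF \<Lambda>', of "global_flow t \<Lambda>"] by blast
  have c: "control_from t \<gamma>"
    by (rule control_from_relaxed[OF \<gamma>])
  define p where "p x = (if x \<in> stopped_paths t
    then measure (section_measure t \<Lambda> x) (space (path_controls t)) else 0)" for x
  have "(\<integral>\<^sup>+x. ennreal (p x) \<partial>count_space UNIV) = (\<Sum>x\<in>stopped_paths t. ennreal (p x))"
    by (intro nn_integral_count_space') (auto simp: p_def)
  also have "\<dots> = ennreal (\<Sum>x\<in>stopped_paths t. p x)"
    by (rule sum_ennreal) (simp add: p_def)
  also have "(\<Sum>x\<in>stopped_paths t. p x) = 1"
    using sum_measure_section[OF \<Lambda>'] by (simp add: p_def)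
  finally have p: "pmf (embed_pmf p) x = p x" for x
    by (intro pmf_embed_pmf) (auto simp: p_def)
  let ?\<mu> = "embed_pmf p"
  have \<mu>': "set_pmf ?\<mu> \<subseteq> stopped_paths t"
    by (auto simp: set_pmf_iff p p_def split: if_splits)
  have mass: "measure (section_measure t \<Lambda> x) (space (path_controls t)) = pmf ?\<mu> x"
    if "x \<in> stopped_paths t" for x
    using that by (simp add: p p_def)
  have law: "global_law t \<Lambda> = relaxed_law t ?\<mu> \<gamma>"
    by (rule global_law_eq_relaxed_law[OF \<Lambda>' c \<mu>' \<open>t \<le> T\<close>]) (simp_all add: mass dis)
  \<comment> \<open>Stopping the relaxed law at \<open>t\<close> returns its starting law, and by
    \<open>marg\<close> the same operation gives \<mu>.\<close>
  have "?\<mu> = \<mu>"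
    using map_stop_flow[OF \<mu>', of 0 "T - t" \<gamma>] \<open>t \<le> T\<close> marg by (simp add: law relaxed_law_def)
  note mass = mass[unfolded this] and \<mu>' = \<mu>'[unfolded this] and law = law[unfolded this]
  have "same_regret t \<mu> \<Lambda> \<gamma>"
    unfolding same_regret_def
    by (intro ballI allI section_integral_regret[OF \<Lambda>' c \<mu>' \<open>t \<le> T\<close>]) (simp_all add: mass dis)
  then show ?thesis
    using \<gamma> law by blast
qed

section \<open>Comparison of the approximate set values\<close>

lemma relaxed_law_path_probs:
  assumes "set_pmf \<mu> \<subseteq> stopped_paths t" "t \<le> T"
  shows "relaxed_law t \<mu> \<gamma> \<in> path_probs"
  using set_pmf_flow[OF assms(1), of "T - t" \<gamma>] assms(2) path_probs_if_stopped[of _ T]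
  by (simp add: relaxed_law_def)

text \<open>One half of \<epsilon> pays for the distance from \<open>\<phi>\<close> to the cost, the
  other for the distance from the cost to the value. The averaged regret only shrinks, by a factor
  at most 1.\<close>

lemma V_relax_eps_subset:
  assumes \<mu>: "set_pmf \<mu> \<subseteq> stopped_paths t" and "t \<le> T" "\<epsilon> > 0"
  shows "V_relax_eps (\<epsilon> / 2) t \<mu> \<subseteq> V_global_eps \<epsilon> t \<mu>"
proof
  fix \<phi> assume "\<phi> \<in> V_relax_eps (\<epsilon> / 2) t \<mu>"
  then obtain \<gamma> where \<phi>: "\<phi> \<in> L0 t" and \<gamma>: "\<gamma> \<in> relaxed_controls"
    and opt: "\<And>x. x \<in> stopped_paths t \<Longrightarrow>
      J (relaxed_law t \<mu> \<gamma>) t x \<gamma> \<le> v (relaxed_law t \<mu> \<gamma>) t x + \<epsilon> / 2"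
    and close: "\<And>x. x \<in> stopped_paths t \<Longrightarrow> \<bar>\<phi> x - J (relaxed_law t \<mu> \<gamma>) t x \<gamma>\<bar> \<le> \<epsilon> / 2"
    unfolding V_relax_eps_def M_relax_def fun_norm_le_iff by blast
  obtain \<Lambda> where \<Lambda>: "\<Lambda> \<in> Xi_of t \<mu>" and law: "global_law t \<Lambda> = relaxed_law t \<mu> \<gamma>"
    and regret: "same_regret t \<mu> \<Lambda> \<gamma>"
    using global_of_relaxed[OF \<gamma> \<mu> \<open>t \<le> T\<close>] by blast
  have ge: "v (relaxed_law t \<mu> \<gamma>) t x \<le> J (relaxed_law t \<mu> \<gamma>) t x \<gamma>" if "x \<in> stopped_paths t" for x
    by (rule v_le_J[OF \<gamma> relaxed_law_path_probs[OF \<mu> \<open>t \<le> T\<close>] that \<open>t \<le> T\<close>])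
  have "section_integral \<Lambda> x (\<lambda>\<alpha>. J (global_law t \<Lambda>) t x (dirac_control \<alpha>) - v (global_law t \<Lambda>) t x) \<le> \<epsilon>"
    if x: "x \<in> stopped_paths t" for x
  proof -
    have "pmf \<mu> x * (J (relaxed_law t \<mu> \<gamma>) t x \<gamma> - v (relaxed_law t \<mu> \<gamma>) t x) \<le> 1 * \<epsilon>"
      using opt[OF x] ge[OF x] \<open>\<epsilon> > 0\<close> by (intro mult_mono) (auto simp: pmf_le_1)
    then show ?thesis
      by (simp add: same_regretD[OF regret x, unfolded law] law)
  qed
  moreover have "\<bar>\<phi> x - v (global_law t \<Lambda>) t x\<bar> \<le> \<epsilon>" if x: "x \<in> stopped_paths t" for x
    using opt[OF x] ge[OF x] close[OF x] unfolding law by linarith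
  ultimately show "\<phi> \<in> V_global_eps \<epsilon> t \<mu>"
    using \<phi> \<Lambda> by (auto simp: V_global_eps_def M_global_def fun_norm_le_iff)
qed

text \<open>The factor \<open>c\<close> compensates for dividing the averaged regret by a mass at
  least \<open>c\<close>, leaving a regret of at most \<epsilon>/2. With \<open>c \<le> 1\<close>
  the distance to the value is also at most \<epsilon>/2, and the two add up.\<close>

lemma V_global_eps_subset:
  assumes \<mu>: "set_pmf \<mu> \<subseteq> stopped_paths t" and "t \<le> T" "\<epsilon> > 0"
    and c: "0 < c" "c \<le> 1" "\<And>x. x \<in> stopped_paths t \<Longrightarrow> c \<le> pmf \<mu> x"
  shows "V_global_eps (c * \<epsilon> / 2) t \<mu> \<subseteq> V_relax_eps \<epsilon> t \<mu>"
proof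
  fix \<phi> assume "\<phi> \<in> V_global_eps (c * \<epsilon> / 2) t \<mu>"
  then obtain \<Lambda> where \<phi>: "\<phi> \<in> L0 t" and \<Lambda>: "\<Lambda> \<in> Xi_of t \<mu>"
    and opt: "\<And>x. x \<in> stopped_paths t \<Longrightarrow> section_integral \<Lambda> x
      (\<lambda>\<alpha>. J (global_law t \<Lambda>) t x (dirac_control \<alpha>) - v (global_law t \<Lambda>) t x) \<le> c * \<epsilon> / 2"
    and close: "\<And>x. x \<in> stopped_paths t \<Longrightarrow> \<bar>\<phi> x - v (global_law t \<Lambda>) t x\<bar> \<le> c * \<epsilon> / 2"
    unfolding V_global_eps_def M_global_def fun_norm_le_iff by blast
  obtain \<gamma> where \<gamma>: "\<gamma> \<in> relaxed_controls" and law: "global_law t \<Lambda> = relaxed_law t \<mu> \<gamma>"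
    and regret: "same_regret t \<mu> \<Lambda> \<gamma>"
    using relaxed_of_global[OF \<Lambda> \<open>t \<le> T\<close>] by blast
  have ge: "v (relaxed_law t \<mu> \<gamma>) t x \<le> J (relaxed_law t \<mu> \<gamma>) t x \<gamma>" if "x \<in> stopped_paths t" for x
    by (rule v_le_J[OF \<gamma> relaxed_law_path_probs[OF \<mu> \<open>t \<le> T\<close>] that \<open>t \<le> T\<close>])
  have le: "J (relaxed_law t \<mu> \<gamma>) t x \<gamma> \<le> v (relaxed_law t \<mu> \<gamma>) t x + \<epsilon> / 2"
    if x: "x \<in> stopped_paths t" for x
  proof -
    let ?d = "J (relaxed_law t \<mu> \<gamma>) t x \<gamma> - v (relaxed_law t \<mu> \<gamma>) t x"
    have "c * ?d \<le> pmf \<mu> x * ?d"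
      using ge[OF x] c(3)[OF x] by (intro mult_right_mono) auto
    also have "\<dots> \<le> c * (\<epsilon> / 2)"
      using opt[OF x] by (simp add: same_regretD[OF regret x, unfolded law] law)
    finally show ?thesis
      using c(1) by simp
  qed
  have "c * \<epsilon> \<le> \<epsilon>"
    using c(2) \<open>\<epsilon> > 0\<close> by simp
  then have "\<bar>\<phi> x - J (relaxed_law t \<mu> \<gamma>) t x \<gamma>\<bar> \<le> \<epsilon>" if x: "x \<in> stopped_paths t" for x
    using le[OF x] ge[OF x] close[OF x] unfolding law by linarith
  moreover have "J (relaxed_law t \<mu> \<gamma>) t x \<gamma> \<le> v (relaxed_law t \<mu> \<gamma>) t x + \<epsilon>"
    if x: "x \<in> stopped_paths t" for x
    using le[OF x] \<open>\<epsilon> > 0\<close> by linarith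
  ultimately show "\<phi> \<in> V_relax_eps \<epsilon> t \<mu>"
    using \<phi> \<gamma> by (auto simp: V_relax_eps_def M_relax_def fun_norm_le_iff)
qed

lemma V_relax_eq_V_global:
  assumes "t \<le> T" "\<mu> \<in> full_support_probs t"
  shows "V_relax t \<mu> = V_global t \<mu>"
proof
  have \<mu>: "set_pmf \<mu> = stopped_paths t"
    using assms(2) by (simp add: full_support_probs_def)
  show "V_relax t \<mu> \<subseteq> V_global t \<mu>"
    unfolding V_relax_def V_global_def
  proof (rule INT_greatest)
    fix \<epsilon> :: real assume "\<epsilon> \<in> {0<..}"
    then show "(\<Inter>\<epsilon>\<in>{0<..}. V_relax_eps \<epsilon> t \<mu>) \<subseteq> V_global_eps \<epsilon> t \<mu>"
      using V_relax_eps_subset[of \<mu> t \<epsilon>] assms(1) \<mu>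
      by (intro order_trans[OF INT_lower[of "\<epsilon> / 2"]]) auto
  qed
  \<comment> \<open>Full support makes this minimum over a finite nonempty set positive.\<close>
  define c where "c = Min (pmf \<mu> ` stopped_paths t)"
  have c: "c \<le> pmf \<mu> x" if "x \<in> stopped_paths t" for x
    using that by (simp add: c_def)
  have "c \<in> pmf \<mu> ` stopped_paths t"
    unfolding c_def by (intro Min_in) (auto simp: stopped_paths_nonempty)
  then have "0 < c" "c \<le> 1"
    using \<mu> by (auto simp: pmf_positive pmf_le_1)
  show "V_global t \<mu> \<subseteq> V_relax t \<mu>"
    unfolding V_relax_def V_global_def
  proof (rule INT_greatest)
    fix \<epsilon> :: real assume "\<epsilon> \<in> {0<..}"
    then show "(\<Inter>\<epsilon>\<in>{0<..}. V_global_eps \<epsilon> t \<mu>) \<subseteq> V_relax_eps \<epsilon> t \<mu>"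
      using V_global_eps_subset[of \<mu> t \<epsilon> c] assms(1) \<mu> c \<open>0 < c\<close> \<open>c \<le> 1\<close>
      by (intro order_trans[OF INT_lower[of "c * \<epsilon> / 2"]]) auto
  qed
qed

end

theorem theorem4p5:
  fixes T :: nat
    and A :: "'a::euclidean_space set"
    and q :: "nat \<Rightarrow> (nat \<Rightarrow> 's::finite) \<Rightarrow> (nat \<Rightarrow> 's) pmf \<Rightarrow> 'a \<Rightarrow> 's \<Rightarrow> real"
    and F :: "nat \<Rightarrow> (nat \<Rightarrow> 's) \<Rightarrow> (nat \<Rightarrow> 's) pmf \<Rightarrow> 'a \<Rightarrow> real"
    and G :: "(nat \<Rightarrow> 's) \<Rightarrow> (nat \<Rightarrow> 's) pmf \<Rightarrow> real"
    and c_q L_q C_0 :: real and \<rho> :: "real \<Rightarrow> real"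
    and t :: nat and \<mu> :: "(nat \<Rightarrow> 's) pmf"
  assumes "mfg T A q F G c_q L_q C_0 \<rho>"
    and "t \<le> T"
    and "\<mu> \<in> mfg_data.full_support_probs T t"
  shows "mfg_data.V_relax T A q F G t \<mu> = mfg_data.V_global T A q F G t \<mu>"
  using mfg.V_relax_eq_V_global[OF assms] .

end
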